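(* Let $\mathcal{L}\subset\mathbb{S}^{d_1d_2}$ be the linear space of symmetric matrices for quantum optimal transport (QOT). The Gibbs manifold $\mathrm{GM}(\mathcal{L})$ is a semialgebraic subset of $\mathbb{S}^{d_1d_2}_+$. It consists of all symmetric matrices $Y\otimes Z$, where $Y\in\mathbb{S}^{d_1}_+$ and $Z\in\mathbb{S}^{d_2}_+$. The Gibbs variety $\mathrm{GV}(\mathcal{L})\subset\mathbb{S}^{d_1d_2}$ is linearly isomorphic to the cone over the Segre variety $\mathbb{P}^{\binom{d_1+1}{2}-1}\times\mathbb{P}^{\binom{d_2+1}{2}-1}$.
   Context: $\mathbb{S}^m$ is the space of real symmetric $m\times m$ matrices with the trace inner product $\langle X,Y\rangle=\mathrm{trace}(XY)$, and $\mathbb{S}^m_+$ is the closed cone of positive semidefinite matrices. Rows and columns of $X=(x_{ijkl})\in\mathbb{S}^{d_1d_2}$ are indexed by pairs $(i,j),(k,l)\in[d_1]\times[d_2]$. The marginalization map is the linear map $\mu:\mathbb{S}^{d_1d_2}\to\mathbb{S}^{d_1}\times\mathbb{S}^{d_2}$, $X\mapsto(Y,Z)$, given by the partial traces $y_{ik}=\sum_{j=1}^{d_2}x_{ijkj}$ and $z_{jl}=\sum_{i=1}^{d_1}x_{ijil}$. QOT is the problem of minimizing a linear function $X\mapsto\langle C,X\rangle$ over the positive semidefinite matrices $X$ with prescribed $\mu(X)$. The linear space $\mathcal{L}\subset\mathbb{S}^{d_1d_2}$ for QOT is the span of the symmetric matrices $A$ for which $X\mapsto\langle A,X\rangle$ is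 one of the coordinate entries $y_{ik}$ or $z_{jl}$ of $\mu(X)$; explicitly, $\mathcal{L}=\{A\otimes\mathrm{id}_{d_2}+\mathrm{id}_{d_1}\otimes B: A\in\mathbb{S}^{d_1},\,B\in\mathbb{S}^{d_2}\}$. The Gibbs manifold is $\mathrm{GM}(\mathcal{L})=\exp(\mathcal{L})$ (matrix exponential), and the Gibbs variety $\mathrm{GV}(\mathcal{L})$ is its Zariski closure in the space of complex symmetric $d_1d_2\times d_1d_2$ matrices (so in the inclusion $\mathrm{GV}(\mathcal{L})\subset\mathbb{S}^{d_1d_2}$ the matrix space is taken over $\mathbb{C}$). $Y\otimes Z$ is the Kronecker product, with entries $x_{ijkl}=y_{ik}z_{jl}$.
   Formalization: With S_+ the closed cone, "consists of all Y⊗Z" fails (0⊗0 is not an exponential); proved instead: GM(L) is the set of all Y⊗Z with Y and Z positive definite, and its closure is the set of all Y⊗Z with Y and Z positive semidefinite. *)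

theory Defs
  imports "HOL-Analysis.Analysis"
begin

section \<open>Symmetric matrices and semidefinite cones\<close>

definition sym_mats :: "('a^'n^'n) set" where
  "sym_mats = {A. transpose A = A}"

definition psd_cone :: "(real^'n^'n) set" where
  "psd_cone = {A \<in> sym_mats. \<forall>x. x \<bullet> (A *v x) \<ge> 0}"

definition pd_cone :: "(real^'n^'n) set" where
  "pd_cone = {A \<in> sym_mats. \<forall>x. x \<noteq> 0 \<longrightarrow> x \<bullet> (A *v x) > 0}"

definition kronecker :: "'a::times^'m^'m \<Rightarrow> 'a^'n^'n \<Rightarrow> 'a^('m \<times> 'n)^('m \<times> 'n)"
    (infixl \<open>\<otimes>\<^sub>K\<close> 75) where
  "Y \<otimes>\<^sub>K Z = (\<chi> r c. Y $ fst r $ fst c * Z $ snd r $ snd c)"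


section \<open>Matrix exponential and Gibbs manifold\<close>

text \<open>The product of the type \<open>vec\<close> is entrywise, so neither the overloaded power nor the
  overloaded exponential is the one of the matrix algebra.\<close>

definition mat_power :: "'a::semiring_1^'n^'n \<Rightarrow> nat \<Rightarrow> 'a^'n^'n" where
  "mat_power A k = (((**) A) ^^ k) (mat 1)"

definition mat_exp :: "real^'n^'n \<Rightarrow> real^'n^'n" where
  "mat_exp A = (\<Sum>k. mat_power A k /\<^sub>R fact k)"

definition gibbs_manifold :: "(real^'n^'n) set \<Rightarrow> (real^'n^'n) set" where
  "gibbs_manifold L = mat_exp ` L"


section \<open>Semialgebraic sets\<close>

text \<open>\<open>V\<close> is meant to be a linear subspace of the ambient space. The polynomial functions on
  \<open>V\<close> are then the restrictions of those on the ambient space, and a semialgebraic subset of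
  \<open>V\<close> is a finite union of solution sets of finite systems of polynomial equations and strict
  polynomial inequalities.\<close>

definition semialgebraic_in :: "'a::real_normed_vector set \<Rightarrow> 'a set \<Rightarrow> bool" where
  "semialgebraic_in V S \<longleftrightarrow>
     (\<exists>\<F> :: (('a \<Rightarrow> real) set \<times> ('a \<Rightarrow> real) set) set.
        finite \<F> \<and>
        (\<forall>(P, Q)\<in>\<F>. finite P \<and> finite Q \<and> (\<forall>p\<in>P \<union> Q. real_polynomial_function p)) \<and>
        S = (\<Union>(P, Q)\<in>\<F>. {x \<in> V. (\<forall>p\<in>P. p x = 0) \<and> (\<forall>q\<in>Q. q x > 0)}))"


section \<open>Zariski closure and Gibbs variety\<close>

inductive matrix_polynomial_function :: "('a::comm_ring_1^'n^'m \<Rightarrow> 'a) \<Rightarrow> bool" where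
  entry: "matrix_polynomial_function (\<lambda>X. X $ i $ j)"
| const: "matrix_polynomial_function (\<lambda>X. c)"
| add: "\<lbrakk>matrix_polynomial_function p; matrix_polynomial_function q\<rbrakk>
    \<Longrightarrow> matrix_polynomial_function (\<lambda>X. p X + q X)"
| mult: "\<lbrakk>matrix_polynomial_function p; matrix_polynomial_function q\<rbrakk>
    \<Longrightarrow> matrix_polynomial_function (\<lambda>X. p X * q X)"

definition zariski_closure_in :: "('a::comm_ring_1^'n^'m) set \<Rightarrow> ('a^'n^'m) set \<Rightarrow> ('a^'n^'m) set" where
  "zariski_closure_in V S =
     {X \<in> V. \<forall>p. matrix_polynomial_function p \<and> (\<forall>Y\<in>S. p Y = 0) \<longrightarrow> p X = 0}"

definition gibbs_variety :: "(real^'n^'n) set \<Rightarrow> (complex^'n^'n) set" where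
  "gibbs_variety L = zariski_closure_in sym_mats (map_matrix complex_of_real ` gibbs_manifold L)"


section \<open>Cones over Segre varieties\<close>

text \<open>A point of projective space is a line through the origin, as a set of vectors. The space
  \<open>complex^('n \<times> 'm)\<close> is the tensor product of \<open>complex^'n\<close> and \<open>complex^'m\<close>.\<close>

definition proj_point :: "'a::field^'n \<Rightarrow> ('a^'n) set" where
  "proj_point x = {c *s x | c. True}"

definition tensor_vec :: "'a::times^'n \<Rightarrow> 'a^'m \<Rightarrow> 'a^('n \<times> 'm)" where
  "tensor_vec u v = (\<chi> p. u $ fst p * v $ snd p)"

definition segre_variety :: "('a::field^('n::finite \<times> 'm::finite)) set set" where
  "segre_variety = {proj_point (tensor_vec u v) | u v. u \<noteq> 0 \<and> v \<noteq> 0}"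

definition affine_cone :: "('a::field^'n) set set \<Rightarrow> ('a^'n) set" where
  "affine_cone V = insert 0 (\<Union>V)"

text \<open>Linear isomorphism of a set of vectors with a set of matrices: a linear bijection
  between their linear spans that maps one set onto the other.\<close>

definition linearly_isomorphic :: "('a::field^'k) set \<Rightarrow> ('a^'n^'m) set \<Rightarrow> bool" where
  "linearly_isomorphic S T \<longleftrightarrow>
     (\<exists>f. Vector_Spaces.linear (*s) (\<lambda>c. map_matrix ((*) c)) f \<and> inj_on f (vec.span S) \<and> f ` S = T)"


section \<open>The linear space of quantum optimal transport\<close>

definition marginalization ::
    "real^('m::finite \<times> 'n::finite)^('m \<times> 'n) \<Rightarrow> (real^'m^'m) \<times> (real^'n^'n)" where
  "marginalization X =
     ((\<chi> i k. \<Sum>j\<in>UNIV. X $ (i, j) $ (k, j)), (\<chi> j l. \<Sum>i\<in>UNIV. X $ (i, j) $ (i, l)))"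

definition qot_space :: "(real^('m::finite \<times> 'n::finite)^('m \<times> 'n)) set" where
  "qot_space = span {A \<in> sym_mats.
     (\<exists>i k. \<forall>X\<in>sym_mats. trace (A ** X) = fst (marginalization X) $ i $ k) \<or>
     (\<exists>j l. \<forall>X\<in>sym_mats. trace (A ** X) = snd (marginalization X) $ j $ l)}"

text \<open>The rest of the theory derives the explicit description \<open>qot_space_eq\<close> of this space.\<close>

lemma sym_mats_trace_eqI:
  fixes A B :: "real^'n^'n"
  assumes "A \<in> sym_mats" "B \<in> sym_mats" "\<And>X. X\<in>sym_mats \<Longrightarrow> trace (A ** X) = trace (B ** X)"
  shows "A = B"
proof -
  define D where "D = A - B"
  have Dij: "D $ i $ j = D $ j $ i" for i j
    using assms(1,2) by (auto simp: D_def sym_mats_def transpose_def vec_eq_iff)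
  then have "D \<in> sym_mats"
    by (simp add: sym_mats_def transpose_def vec_eq_iff)
  then have "trace (A ** D) - trace (B ** D) = 0"
    using assms(3) by simp
  then have "trace (D ** D) = 0"
    by (simp add: D_def trace_def matrix_matrix_mult_def left_diff_distrib sum_subtractf)
  moreover have "trace (D ** D) = (\<Sum>i\<in>UNIV. \<Sum>j\<in>UNIV. D $ i $ j * D $ i $ j)"
    unfolding trace_def matrix_matrix_mult_def vec_lambda_beta
    by (intro sum.cong refl arg_cong2[where f = "(*)"] Dij)
  ultimately have "(\<Sum>i\<in>UNIV. \<Sum>j\<in>UNIV. D $ i $ j * D $ i $ j) = 0"
    by simp
  then have "D $ i $ j = 0" for i j
    by (simp add: sum_nonneg_eq_0_iff sum_nonneg)
  then show ?thesis
    by (simp add: D_def vec_eq_iff)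
qed

definition sym_unit :: "'n \<Rightarrow> 'n \<Rightarrow> real^'n^'n" where
  "sym_unit i k = (\<chi> a b. (if a = i \<and> b = k then 1/2 else 0) + (if a = k \<and> b = i then 1/2 else 0))"

lemma sym_unit_in_sym_mats: "sym_unit i k \<in> sym_mats"
  unfolding sym_mats_def mem_Collect_eq transpose_def sym_unit_def vec_eq_iff vec_lambda_beta
proof (intro allI)
  fix a b
  have "(b = i \<and> a = k) = (a = k \<and> b = i)" "(b = k \<and> a = i) = (a = i \<and> b = k)"
    by blast+
  then show "(if b = i \<and> a = k then 1/2 else 0) + (if b = k \<and> a = i then 1/2 else 0) =
      (if a = i \<and> b = k then 1/2 else (0::real)) + (if a = k \<and> b = i then 1/2 else 0)"
    by (simp only: add.commute)
qed

lemma kronecker_in_sym_mats: "A \<in> sym_mats \<Longrightarrow> B \<in> sym_mats \<Longrightarrow> (A::real^'m^'m) \<otimes>\<^sub>K (B::real^'n^'n) \<in> sym_mats"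
  by (auto simp: kronecker_def sym_mats_def transpose_def vec_eq_iff)

lemma mat_1_in_sym_mats: "(mat 1::real^'n^'n) \<in> sym_mats"
  by (auto simp: mat_def sym_mats_def transpose_def vec_eq_iff)

lemma sum_half_indicator: "(\<Sum>x\<in>UNIV. \<Sum>y\<in>UNIV. (if x = i \<and> y = k then 1/2 else 0) * f x y) = f i (k::'a::finite) / (2::real)"
  for i :: "'b::finite"
proof -
  have "(\<Sum>y\<in>UNIV. (if x = i \<and> y = k then 1/2 else 0) * f x y) = (if x = i then f i k / 2 else 0)" for x
  proof -
    have "(\<Sum>y\<in>UNIV. (if x = i \<and> y = k then 1/2 else 0) * f x y)
        = (\<Sum>y\<in>UNIV. if y = k then if x = i then f i k / 2 else 0 else 0)"
      by (intro sum.cong) auto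
    then show ?thesis by simp
  qed
  then show ?thesis by (simp del: times_divide_eq_left)
qed

lemma trace_sym_unit: "X \<in> sym_mats \<Longrightarrow> trace (sym_unit i k ** X) = X $ i $ k"
proof -
  assume X: "X \<in> sym_mats"
  have "trace (sym_unit i k ** X) = X $ k $ i / 2 + X $ i $ k / 2"
    by (simp add: trace_def matrix_matrix_mult_def sym_unit_def distrib_right sum.distrib
      sum_half_indicator[where f="\<lambda>x y. X $ y $ x"])
  moreover have "X $ k $ i = X $ i $ k" using X by (auto simp: sym_mats_def transpose_def vec_eq_iff)
  ultimately show ?thesis by simp
qed

lemma sum_UNIV_prod: "(\<Sum>p\<in>UNIV. f p) = (\<Sum>a\<in>UNIV. \<Sum>b\<in>UNIV. f (a,b))"
  for f :: "'a::finite \<times> 'b::finite \<Rightarrow> real"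
  unfolding UNIV_Times_UNIV[symmetric] by (simp add: sum.cartesian_product)

lemma trace_kronecker1: "trace ((A \<otimes>\<^sub>K mat 1) ** X) = trace (A ** fst (marginalization X))"
  apply (simp add: trace_def matrix_matrix_mult_def kronecker_def marginalization_def mat_def sum_UNIV_prod sum_distrib_left if_distrib if_distribR cong: if_cong)
  apply (intro sum.cong refl)
  apply (rule sum.swap)
  done

lemma trace_kronecker2: "trace ((mat 1 \<otimes>\<^sub>K B) ** X) = trace (B ** snd (marginalization X))"
proof -
  have *: "(\<Sum>a\<in>UNIV. \<Sum>b\<in>UNIV. (if i = a then 1 else 0) * g b * f a b) = (\<Sum>b\<in>UNIV. g b * (f i b::real))" for i::'a and g f
  proof -
    have "(\<Sum>a\<in>UNIV. \<Sum>b\<in>UNIV. (if i = a then 1 else 0) * g b * f a b) = (\<Sum>a\<in>UNIV. if i = a then \<Sum>b\<in>UNIV. g b * f a b else 0)"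
     by (intro sum.cong refl) auto
    then show ?thesis by simp
  qed
  show ?thesis
  apply (simp add: trace_def matrix_matrix_mult_def kronecker_def marginalization_def mat_def sum_UNIV_prod sum_distrib_left *)
  apply (subst sum.swap)
  apply (subst (2) sum.swap)
  apply (rule trans[OF sum.cong[OF refl sum.swap]])
  apply (rule sum.swap)
  done
qed

lemma marginalization_in_sym_mats: "X \<in> sym_mats \<Longrightarrow> fst (marginalization X) \<in> sym_mats \<and> snd (marginalization X) \<in> sym_mats"
  by (auto simp: marginalization_def sym_mats_def transpose_def vec_eq_iff intro!: sum.cong)

lemma sym_mats_decomp: assumes "A \<in> sym_mats" shows "A = (\<Sum>i\<in>UNIV. \<Sum>k\<in>UNIV. A $ i $ k *\<^sub>R sym_unit i k)"
proof -
  have "A $ b $ a = A $ a $ b" for a b using assms by (auto simp: sym_mats_def transpose_def vec_eq_iff)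
  moreover have "(\<Sum>i\<in>UNIV. \<Sum>k\<in>UNIV. A $ i $ k *\<^sub>R sym_unit i k) $ a $ b = A $ a $ b / 2 + A $ b $ a / 2" for a b
  proof -
    have "(\<Sum>i\<in>UNIV. \<Sum>k\<in>UNIV. A $ i $ k *\<^sub>R sym_unit i k) $ a $ b = 
      (\<Sum>i\<in>UNIV. \<Sum>k\<in>UNIV. (if i = a \<and> k = b then 1/2 else 0) * A $ i $ k) + (\<Sum>i\<in>UNIV. \<Sum>k\<in>UNIV. (if i = b \<and> k = a then 1/2 else 0) * A $ i $ k)"
      unfolding sum.distrib[symmetric] sum_component vector_scaleR_component sym_unit_def vec_lambda_beta
      apply (intro sum.cong refl)
      apply (simp only: real_scaleR_def distrib_left distrib_right)
      apply (simp only: mult.commute eq_commute conj_commute)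
      done
    then show ?thesis by (simp add: sum_half_indicator)
  qed
  ultimately have "(\<Sum>i\<in>UNIV. \<Sum>k\<in>UNIV. A $ i $ k *\<^sub>R sym_unit i k) $ a $ b = A $ a $ b" for a b
    by (metis field_sum_of_halves)
  then show ?thesis
    unfolding vec_eq_iff by metis
qed

lemma linear_kronecker_left: "linear (\<lambda>A. A \<otimes>\<^sub>K (B::real^'n^'n))" and linear_kronecker_right: "linear (\<lambda>A. (B::real^'n^'n) \<otimes>\<^sub>K A)"
  by (auto intro!: linearI simp: kronecker_def vec_eq_iff algebra_simps)

lemma subspace_sym_mats: "subspace (sym_mats :: (real^'n^'n) set)"
  by (auto simp: subspace_def sym_mats_def transpose_def vec_eq_iff)

lemma qot_space_eq:
  "qot_space = {A \<otimes>\<^sub>K mat 1 + mat 1 \<otimes>\<^sub>K B | (A :: real^'m^'m) (B :: real^'n^'n).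
     A \<in> sym_mats \<and> B \<in> sym_mats}" (is "_ = ?R")
proof
  have R: "?R = {x + y | x y. x \<in> (\<lambda>A. A \<otimes>\<^sub>K mat 1) ` sym_mats \<and> y \<in> (\<lambda>B. mat 1 \<otimes>\<^sub>K B) ` sym_mats}"
    by auto
  have 0: "(0::real^'k^'k) \<in> sym_mats" by (simp add: subspace_0 subspace_sym_mats)
  have 1: "A \<otimes>\<^sub>K mat 1 \<in> ?R" if "A \<in> sym_mats" for A
    using that 0 linear_0[OF linear_kronecker_right] by force
  have 2: "mat 1 \<otimes>\<^sub>K A \<in> ?R" if "A \<in> sym_mats" for A
    using that 0 linear_0[OF linear_kronecker_left] by force
  show "qot_space \<subseteq> ?R"
    unfolding qot_space_def
  proof (rule span_minimal)
    show "subspace ?R" unfolding R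
      by (intro subspace_sums linear_subspace_image linear_kronecker_left linear_kronecker_right subspace_sym_mats)
    show "{A \<in> sym_mats.
     (\<exists>i k. \<forall>X\<in>sym_mats. trace (A ** X) = fst (marginalization X) $ i $ k) \<or>
     (\<exists>j l. \<forall>X\<in>sym_mats. trace (A ** X) = snd (marginalization X) $ j $ l)} \<subseteq> ?R"
    proof clarify
      fix A :: "real^('m \<times> 'n)^('m \<times> 'n)"
      assume A: "A \<in> sym_mats" and
        "(\<exists>i k. \<forall>X\<in>sym_mats. trace (A ** X) = fst (marginalization X) $ i $ k) \<or>
         (\<exists>j l. \<forall>X\<in>sym_mats. trace (A ** X) = snd (marginalization X) $ j $ l)"
      then consider (a) i k where "\<forall>X\<in>sym_mats. trace (A ** X) = fst (marginalization X) $ i $ k"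
        | (b) j l where "\<forall>X\<in>sym_mats. trace (A ** X) = snd (marginalization X) $ j $ l" by blast
      then have "A \<in> ?R"
      proof cases
        case a
        have "A = sym_unit i k \<otimes>\<^sub>K mat 1"
          by (rule sym_mats_trace_eqI) (use a A in \<open>auto simp: kronecker_in_sym_mats sym_unit_in_sym_mats mat_1_in_sym_mats trace_kronecker1 trace_sym_unit marginalization_in_sym_mats\<close>)
        then show ?thesis using 1[OF sym_unit_in_sym_mats] by (simp only:)
      next
        case b
        have "A = mat 1 \<otimes>\<^sub>K sym_unit j l"
          by (rule sym_mats_trace_eqI) (use b A in \<open>auto simp: kronecker_in_sym_mats sym_unit_in_sym_mats mat_1_in_sym_mats trace_kronecker2 trace_sym_unit marginalization_in_sym_mats\<close>)
        then show ?thesis using 2[OF sym_unit_in_sym_mats] by (simp only:)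
      qed
      then show "\<exists>Aa B. A = Aa \<otimes>\<^sub>K mat 1 + mat 1 \<otimes>\<^sub>K B \<and> Aa \<in> sym_mats \<and> B \<in> sym_mats"
        unfolding mem_Collect_eq .
    qed
  qed
  have g1: "sym_unit i k \<otimes>\<^sub>K mat 1 \<in> (qot_space::(real^('m \<times> 'n)^('m \<times> 'n)) set)" for i k
    unfolding qot_space_def
    by (rule span_base, rule CollectI, rule conjI, intro kronecker_in_sym_mats sym_unit_in_sym_mats mat_1_in_sym_mats,
        rule disjI1, rule exI[of _ i], rule exI[of _ k])
       (simp add: trace_kronecker1 trace_sym_unit marginalization_in_sym_mats)
  have g2: "mat 1 \<otimes>\<^sub>K sym_unit i k \<in> (qot_space::(real^('m \<times> 'n)^('m \<times> 'n)) set)" for i k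
    unfolding qot_space_def
    by (rule span_base, rule CollectI, rule conjI, intro kronecker_in_sym_mats sym_unit_in_sym_mats mat_1_in_sym_mats,
        rule disjI2, rule exI[of _ i], rule exI[of _ k])
       (simp add: trace_kronecker2 trace_sym_unit marginalization_in_sym_mats)
  have S: "subspace qot_space" unfolding qot_space_def by simp
  have h1: "A \<otimes>\<^sub>K mat 1 \<in> (qot_space::(real^('m \<times> 'n)^('m \<times> 'n)) set)" if "A \<in> sym_mats" for A
    by (subst sym_mats_decomp[OF that]) (simp add: linear_sum[OF linear_kronecker_left] linear_cmul[OF linear_kronecker_left] subspace_sum[OF S] subspace_scale[OF S] g1)
  have h2: "mat 1 \<otimes>\<^sub>K A \<in> (qot_space::(real^('m \<times> 'n)^('m \<times> 'n)) set)" if "A \<in> sym_mats" for A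
    by (subst sym_mats_decomp[OF that]) (simp add: linear_sum[OF linear_kronecker_right] linear_cmul[OF linear_kronecker_right] subspace_sum[OF S] subspace_scale[OF S] g2)
  show "?R \<subseteq> qot_space" using h1 h2 subspace_add[OF S] by blast
qed

end

theory Submission
  imports Defs
begin

text \<open>
  Matrices \<open>A \<otimes> 1\<close> and \<open>1 \<otimes> B\<close> are diagonalised simultaneously by the Kronecker product of orthogonal
  eigenbases of \<open>A\<close> and \<open>B\<close>, so \<open>exp (A \<otimes> 1 + 1 \<otimes> B) = exp A \<otimes> exp B\<close>, and \<open>exp\<close> maps the symmetric
  matrices onto the positive definite ones. Kronecker products are cut out by the quadrics
  of the Segre variety, and positive definiteness of a symmetric \<open>X\<close> by the positivity of the
  coefficients of \<open>det (X + t)\<close> in \<open>t\<close>. For the Zariski closure, every complex symmetric matrix is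
  the value at \<open>u = \<i>\<close> of a polynomial curve that is real positive definite for real \<open>u\<close>, so a
  polynomial that vanishes on the Gibbs manifold vanishes on all complex symmetric products;
  conversely the quadrics and the invariance under partial transposition pass to the closure.
  A numbering of the unordered pairs of row and column indices then identifies these products
  with the decomposable tensors.
\<close>

section \<open>The spectral theorem for real symmetric matrices\<close>

text \<open>The Rayleigh quotient attains its maximum on the compact unit sphere of
  \<open>S\<close>. Invariance puts the residual \<open>u\<close> of a maximiser in
  \<open>S\<close>, and a nonzero residual would be a direction of ascent.\<close>

lemma selfadjoint_max_eigenvector:
  fixes f :: "'a::euclidean_space \<Rightarrow> 'a"
  assumes f: "linear f" and sa: "\<And>x y. f x \<bullet> y = x \<bullet> f y"
    and S: "subspace S" and inv: "f ` S \<subseteq> S" and ne: "S \<noteq> {0}"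
  obtains v c where "v \<in> S" "norm v = 1" "f v = c *\<^sub>R v"
proof -
  define K where "K = sphere 0 1 \<inter> S"
  have "compact K"
    unfolding K_def by (intro compact_Int_closed compact_sphere closed_subspace S)
  moreover obtain w where w: "w \<in> S" "w \<noteq> 0"
    using ne subspace_0[OF S] by auto
  then have "(1 / norm w) *\<^sub>R w \<in> K"
    by (simp add: K_def subspace_scale[OF S])
  then have "K \<noteq> {}" by auto
  moreover have "continuous_on K (\<lambda>x. x \<bullet> f x)"
    by (intro continuous_intros linear_continuous_on linear_conv_bounded_linear[THEN iffD1] f)
  ultimately obtain v where v: "v \<in> K" and max: "\<And>x. x \<in> K \<Longrightarrow> x \<bullet> f x \<le> v \<bullet> f v"
    using continuous_attains_sup[of K "\<lambda>x. x \<bullet> f x"] by blast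
  define c where "c = v \<bullet> f v"
  have nv: "v \<bullet> v = 1" "norm v = 1" and vS: "v \<in> S"
    using v by (auto simp: K_def dot_square_norm)
  have le: "x \<bullet> f x \<le> c * (x \<bullet> x)" if "x \<in> S" for x
  proof (cases "x = 0")
    case False
    then have "(1 / norm x) *\<^sub>R x \<in> K"
      using that by (simp add: K_def subspace_scale[OF S])
    from max[OF this] have "(x \<bullet> f x) / (norm x)\<^sup>2 \<le> c"
      by (simp add: linear_scale[OF f] c_def power2_eq_square)
    then show ?thesis
      using False by (simp add: divide_le_eq dot_square_norm)
  qed (simp add: linear_0[OF f])
  \<comment> \<open>The Rayleigh quotient is stationary at its maximum \<open>v\<close>, in particular in the direction \<open>u\<close>.\<close>
  define u where "u = f v - c *\<^sub>R v"
  have uS: "u \<in> S"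
    using inv vS by (auto simp: u_def intro!: subspace_diff subspace_scale S)
  have "f v = c *\<^sub>R v"
  proof (rule ccontr)
    assume "f v \<noteq> c *\<^sub>R v"
    then have u0: "u \<bullet> u > 0" by (simp add: u_def)
    define q where "q = c * (u \<bullet> u) - u \<bullet> f u"
    have uu: "u \<bullet> f v - c * (u \<bullet> v) = u \<bullet> u"
      by (simp add: u_def inner_diff_right)
    \<comment> \<open>Expansion of \<open>le\<close> at the perturbed vector: the constant terms
      cancel, self-adjointness merges the cross terms, and \<open>uu\<close> turns the linear
      coefficient into twice \<open>u \<bullet> u\<close>.\<close>
    have *: "2 * t * (u \<bullet> u) \<le> t\<^sup>2 * q" for t
    proof -
      have "v + t *\<^sub>R u \<in> S" using vS uS by (intro subspace_add subspace_scale S)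
      from le[OF this] have "c + 2 * t * (u \<bullet> f v) + t\<^sup>2 * (u \<bullet> f u)
          \<le> c * (1 + 2 * t * (u \<bullet> v) + t\<^sup>2 * (u \<bullet> u))"
        using sa[of v u] by (simp add: linear_add[OF f] linear_scale[OF f] inner_add_left inner_add_right
          c_def[symmetric] nv power2_eq_square algebra_simps inner_commute)
      then show ?thesis
        unfolding uu[symmetric] q_def by (simp add: algebra_simps)
    qed
    \<comment> \<open>Dividing by \<open>t\<close> leaves
      \<open>2 * (u \<bullet> u) \<le> t * q\<close>, which fails for small \<open>t\<close>; this
      choice makes \<open>t * (1 + \<bar>q\<bar>)\<close> equal to
      \<open>u \<bullet> u\<close>.\<close>
    define t where "t = (u \<bullet> u) / (1 + \<bar>q\<bar>)"
    have t: "t > 0" using u0 by (simp add: t_def)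
    have "2 * (u \<bullet> u) \<le> t * q" 
      using *[of t] t by (simp add: power2_eq_square)
    also have "\<dots> \<le> t * (1 + \<bar>q\<bar>)" using t by (intro mult_left_mono) auto
    also have "\<dots> = u \<bullet> u" by (simp add: t_def)
    finally show False using u0 by simp
  qed
  with that vS nv show thesis by blast
qed

text \<open>Induction on the dimension: the orthogonal complement of an eigenvector within
  \<open>S\<close> is again invariant, because \<open>f\<close> is self-adjoint, and has one
  dimension less.\<close>

lemma selfadjoint_eigenbasis:
  fixes f :: "'a::euclidean_space \<Rightarrow> 'a"
  assumes f: "linear f" and sa: "\<And>x y. f x \<bullet> y = x \<bullet> f y"
    and "subspace S" "f ` S \<subseteq> S"
  shows "\<exists>B \<subseteq> S. card B = dim S \<and> finite B \<and> pairwise orthogonal B \<and>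
    (\<forall>v\<in>B. norm v = 1 \<and> (\<exists>c. f v = c *\<^sub>R v))"
  using assms(3,4)
proof (induction "dim S" arbitrary: S rule: less_induct)
  case less
  show ?case
  proof (cases "S = {0}")
    case True
    then show ?thesis by (intro exI[of _ "{}"]) auto
  next
    case False
    obtain v c where v: "v \<in> S" "norm v = 1" "f v = c *\<^sub>R v"
      using selfadjoint_max_eigenvector[OF f sa less.prems False] by blast
    have vv: "v \<bullet> v = 1" using v by (simp add: dot_square_norm)
    define T where "T = {x \<in> S. v \<bullet> x = 0}"
    have T: "subspace T"
      using less.prems(1) by (auto simp: T_def subspace_def inner_add_right)
    have "f ` T \<subseteq> T"
      using less.prems(2) v(3) sa[of v] by (auto simp: T_def) (metis inner_scaleR_left mult_zero_right)
    moreover have "span (insert v T) = S"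
    proof
      show "span (insert v T) \<subseteq> S"
        by (rule span_minimal) (use v less.prems in \<open>auto simp: T_def\<close>)
      show "S \<subseteq> span (insert v T)"
      proof
        fix x assume "x \<in> S"
        then have "x - (v \<bullet> x) *\<^sub>R v \<in> T"
          using v less.prems(1) by (simp add: T_def subspace_diff subspace_scale inner_diff_right vv)
        then show "x \<in> span (insert v T)"
          unfolding span_insert using span_base by blast
      qed
    qed
    then have "dim S = dim (insert v T)"
      by (metis dim_span)
    moreover have "v \<notin> span T" using T vv by (auto simp: span_eq_iff[THEN iffD2] T_def)
    ultimately have "dim S = Suc (dim T)" "f ` T \<subseteq> T"
      by (simp_all add: dim_insert)
    then obtain B where B: "B \<subseteq> T" "card B = dim T" "finite B" "pairwise orthogonal B"
      "\<forall>v\<in>B. norm v = 1 \<and> (\<exists>c. f v = c *\<^sub>R v)"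
      using less.hyps[of T] T by auto
    have "v \<notin> B" using B(1) vv by (auto simp: T_def)
    then show ?thesis
      using B v \<open>dim S = Suc (dim T)\<close>
      by (intro exI[of _ "insert v B"])
        (auto simp: T_def pairwise_insert orthogonal_def inner_commute)
  qed
qed

definition diag_mat :: "('n \<Rightarrow> 'a::zero) \<Rightarrow> 'a^'n^'n" where
  "diag_mat d = (\<chi> i j. if i = j then d i else 0)"

text \<open>For orthogonal \<open>P\<close> this is an eigendecomposition with the columns of
  \<open>P\<close> as eigenvectors. With \<open>P\<close> fixed, the matrix operations become
  pointwise operations on \<open>d\<close>.\<close>

definition spectral_mat :: "real^'n^'n \<Rightarrow> ('n \<Rightarrow> real) \<Rightarrow> real^'n^'n" where
  "spectral_mat P d = P ** diag_mat d ** transpose P"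

lemma mult_diag_mat_nth: "((P :: 'a::semiring_1^'n^'m) ** diag_mat d) $ i $ j = P $ i $ j * d j"
proof -
  have "(P ** diag_mat d) $ i $ j = (\<Sum>k\<in>UNIV. if k = j then P $ i $ j * d j else 0)"
    unfolding matrix_matrix_mult_def diag_mat_def by (auto intro!: sum.cong simp: if_distrib cong: if_cong)
  then show ?thesis by simp
qed

lemma spectral_mat_nth: "spectral_mat P d $ i $ j = (\<Sum>l\<in>UNIV. P $ i $ l * d l * P $ j $ l)"
  unfolding spectral_mat_def by (subst matrix_matrix_mult_def) (simp add: mult_diag_mat_nth transpose_def)

lemma sym_matsD: "A \<in> sym_mats \<Longrightarrow> A $ i $ j = A $ j $ i"
  by (auto simp: sym_mats_def transpose_def vec_eq_iff)

lemma sym_matsI: "(\<And>i j. A $ i $ j = A $ j $ i) \<Longrightarrow> A \<in> sym_mats"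
  by (auto simp: sym_mats_def transpose_def vec_eq_iff)

lemma spectral_mat_sym: "spectral_mat P d \<in> sym_mats"
  by (rule sym_matsI) (simp add: spectral_mat_nth mult.commute mult.left_commute)

lemma spectral_decomposition:
  fixes A :: "real^'n^'n"
  assumes "A \<in> sym_mats"
  obtains P d where "orthogonal_matrix P" "A = spectral_mat P d"
proof -
  have tr: "transpose A = A" using assms by (simp add: sym_mats_def)
  obtain B where B: "card B = CARD('n)" "finite B" "pairwise orthogonal B"
    "\<forall>v\<in>B. norm v = 1 \<and> (\<exists>c. A *v v = c *\<^sub>R v)"
    using selfadjoint_eigenbasis[of "\<lambda>x. A *v x" "UNIV :: (real^'n) set"]
    by (auto simp: matrix_vector_mul_linear dim_UNIV) (metis dot_lmul_matrix tr transpose_matrix_vector)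
  \<comment> \<open>The eigenbasis has as many elements as the index type, so the indices themselves
    can number it.\<close>
  then obtain e where e: "bij_betw e (UNIV :: 'n set) B"
    by (metis finite_class.finite_UNIV finite_same_card_bij)
  have eB: "e i \<in> B" for i using e by (auto simp: bij_betw_def)
  have "\<forall>i. \<exists>c. A *v e i = c *\<^sub>R e i" using B(4) eB by blast
  from choice[OF this] obtain d where d: "\<And>i. A *v e i = d i *\<^sub>R e i" by blast
  define P where "P = (\<chi> i j. e j $ i)"
  have dot: "e i \<bullet> e j = (if i = j then 1 else 0)" for i j
  proof (cases "i = j")
    case True
    then show ?thesis using B(4) eB by (simp add: dot_square_norm)
  next
    case False
    then have "e i \<noteq> e j" using e by (auto simp: bij_betw_def inj_on_def)
    then show ?thesis using B(3) eB False by (auto simp: pairwise_def orthogonal_def)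
  qed
  have P: "orthogonal_matrix P"
    unfolding orthogonal_matrix
    by (simp add: vec_eq_iff matrix_matrix_mult_def transpose_def P_def mat_def dot[unfolded inner_vec_def inner_real_def])
  \<comment> \<open>Column by column this is the eigenvector equation; multiplying by
    \<open>transpose P\<close> on the right isolates \<open>A\<close>.\<close>
  have "A ** P = P ** diag_mat d"
  proof (simp add: vec_eq_iff mult_diag_mat_nth, intro allI)
    fix i j
    have "(A ** P) $ i $ j = (A *v e j) $ i"
      by (simp add: matrix_matrix_mult_def matrix_vector_mult_def P_def)
    also have "\<dots> = P $ i $ j * d j" by (simp add: d P_def)
    finally show "(A ** P) $ i $ j = P $ i $ j * d j" .
  qed
  then have "A ** (P ** transpose P) = spectral_mat P d"
    by (simp add: spectral_mat_def matrix_mul_assoc)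
  then have "A = spectral_mat P d"
    using P by (simp add: orthogonal_matrix_def)
  with P that show thesis by blast
qed

section \<open>Exponentials and Kronecker products in spectral form\<close>

lemma diag_mat_mult: "(diag_mat d :: 'a::semiring_1^'n^'n) ** diag_mat e = diag_mat (\<lambda>i. d i * e i)"
  by (simp add: vec_eq_iff mult_diag_mat_nth) (simp add: diag_mat_def)

lemma spectral_mat_mult:
  assumes "orthogonal_matrix P"
  shows "spectral_mat P d ** spectral_mat P e = spectral_mat P (\<lambda>i. d i * e i)"
proof -
  have "spectral_mat P d ** spectral_mat P e
      = P ** diag_mat d ** (transpose P ** P) ** diag_mat e ** transpose P"
    by (simp add: spectral_mat_def matrix_mul_assoc)
  also have "\<dots> = P ** (diag_mat d ** diag_mat e) ** transpose P"
    using assms by (simp add: orthogonal_matrix_def matrix_mul_assoc)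
  finally show ?thesis by (simp add: spectral_mat_def diag_mat_mult)
qed

lemma diag_mat_const: "diag_mat (\<lambda>_. c) = mat c"
  by (simp add: diag_mat_def mat_def)

lemma spectral_mat_const: "orthogonal_matrix P \<Longrightarrow> spectral_mat P (\<lambda>_. c) = mat c"
proof -
  assume P: "orthogonal_matrix P"
  have "spectral_mat P (\<lambda>_. c) = c *\<^sub>R spectral_mat P (\<lambda>_. 1)"
    by (simp add: vec_eq_iff spectral_mat_nth sum_distrib_left mult.commute mult.left_commute)
  also have "spectral_mat P (\<lambda>_. 1) = mat 1"
    using P by (simp add: spectral_mat_def diag_mat_const orthogonal_matrix_def)
  finally show ?thesis by (simp add: vec_eq_iff mat_def)
qed

lemma spectral_mat_add: "spectral_mat P d + spectral_mat P e = spectral_mat P (\<lambda>i. d i + e i)"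
  by (simp add: vec_eq_iff spectral_mat_nth algebra_simps sum.distrib)

lemma mat_power_spectral:
  assumes "orthogonal_matrix P"
  shows "mat_power (spectral_mat P d) k = spectral_mat P (\<lambda>i. d i ^ k)"
proof (induction k)
  case 0
  then show ?case using assms by (simp add: mat_power_def spectral_mat_const)
next
  case (Suc k)
  have "mat_power (spectral_mat P d) (Suc k) = spectral_mat P d ** mat_power (spectral_mat P d) k"
    by (simp add: mat_power_def)
  then show ?case using assms by (simp add: Suc.IH spectral_mat_mult)
qed

lemma sums_vecI:
  assumes "\<And>i. (\<lambda>k. f k $ i) sums (s $ i)"
  shows "f sums (s :: 'a::real_normed_vector^'n)"
  using assms unfolding sums_def by (intro vec_tendstoI) (simp add: sum_component)

text \<open>Powers act on the eigenvalues alone, so each entry of the series is a finite combination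
  of scalar exponential series.\<close>

lemma mat_exp_spectral:
  assumes "orthogonal_matrix P"
  shows "mat_exp (spectral_mat P d) = spectral_mat P (\<lambda>i. exp (d i))"
proof -
  have "(\<lambda>k. mat_power (spectral_mat P d) k /\<^sub>R fact k) sums spectral_mat P (\<lambda>i. exp (d i))"
  proof (intro sums_vecI)
    fix i j
    have "(\<lambda>k. \<Sum>l\<in>UNIV. P $ i $ l * (d l ^ k /\<^sub>R fact k) * P $ j $ l) sums
        (\<Sum>l\<in>UNIV. P $ i $ l * exp (d l) * P $ j $ l)"
      by (intro sums_sum sums_mult sums_mult2 exp_converges)
    then show "(\<lambda>k. (mat_power (spectral_mat P d) k /\<^sub>R fact k) $ i $ j) sums
        spectral_mat P (\<lambda>i. exp (d i)) $ i $ j"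
      by (simp add: mat_power_spectral[OF assms] spectral_mat_nth sum_distrib_left mult_ac)
  qed
  then show ?thesis unfolding mat_exp_def by (rule sums_unique[symmetric])
qed

section \<open>Definiteness in terms of eigenvalues\<close>

lemma quadratic_form_spectral:
  "x \<bullet> (spectral_mat P d *v x) = (\<Sum>l\<in>UNIV. d l * ((transpose P *v x) $ l)\<^sup>2)"
proof -
  let ?y = "transpose P *v x"
  have "x \<bullet> (spectral_mat P d *v x) = ?y \<bullet> (diag_mat d *v ?y)"
    by (simp add: spectral_mat_def matrix_vector_mul_assoc[symmetric] dot_lmul_matrix transpose_matrix_vector)
  moreover have "(diag_mat d *v ?y) $ l = d l * ?y $ l" for l
  proof -
    have "(diag_mat d *v ?y) $ l = (\<Sum>j\<in>UNIV. if l = j then d l * ?y $ l else 0)"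
      unfolding matrix_vector_mult_def[of "diag_mat d"] vec_lambda_beta
      by (intro sum.cong) (auto simp: diag_mat_def)
    then show ?thesis by simp
  qed
  ultimately show ?thesis
    by (simp add: inner_vec_def power2_eq_square mult_ac)
qed

text \<open>Testing a quadratic form on its eigenvectors is what forces the eigenvalues of a
  definite matrix to be positive.\<close>

lemma spectral_mat_quadratic_form_column:
  fixes P :: "real^'n^'n"
  assumes "orthogonal_matrix P"
  shows "column l P \<bullet> (spectral_mat P d *v column l P) = d l" "column l P \<noteq> 0"
proof -
  have *: "transpose P *v column l P = axis l 1"
    using assms by (metis matrix_vector_mul_assoc matrix_vector_mul_lid matrix_vector_mult_basis orthogonal_matrix_def)
  then show "column l P \<bullet> (spectral_mat P d *v column l P) = d l" "column l P \<noteq> 0"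
    by (simp add: quadratic_form_spectral axis_def power2_eq_square if_distrib if_distribR
        del: transpose_matrix_vector cong: if_cong) (metis * axis_eq_0_iff matrix_vector_mult_0_right zero_neq_one)
qed

lemma spectral_mat_pd_iff:
  assumes P: "orthogonal_matrix P"
  shows "spectral_mat P d \<in> pd_cone \<longleftrightarrow> (\<forall>i. d i > 0)"
proof
  assume "spectral_mat P d \<in> pd_cone"
  then show "\<forall>i. d i > 0"
    using spectral_mat_quadratic_form_column[OF P] by (auto simp: pd_cone_def) metis
next
  assume d: "\<forall>i. d i > 0"
  have "x \<bullet> (spectral_mat P d *v x) > 0" if "x \<noteq> 0" for x
  proof -
    have "transpose P *v x \<noteq> 0"
      using that P by (metis matrix_vector_mul_assoc matrix_vector_mul_lid matrix_vector_mult_0_right orthogonal_matrix_def)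
    then obtain l where "(transpose P *v x) $ l \<noteq> 0" by (auto simp: vec_eq_iff)
    then have "0 < d l * ((transpose P *v x) $ l)\<^sup>2" using d by simp
    then show ?thesis
      unfolding quadratic_form_spectral using d by (intro sum_pos2[of _ l]) (auto intro!: mult_nonneg_nonneg simp: less_imp_le)
  qed
  then show "spectral_mat P d \<in> pd_cone"
    by (simp add: pd_cone_def spectral_mat_sym)
qed

lemma spectral_mat_psd_iff:
  assumes P: "orthogonal_matrix P"
  shows "spectral_mat P d \<in> psd_cone \<longleftrightarrow> (\<forall>i. d i \<ge> 0)"
proof
  assume "spectral_mat P d \<in> psd_cone"
  then show "\<forall>i. d i \<ge> 0"
    using spectral_mat_quadratic_form_column[OF P] by (auto simp: psd_cone_def) metis
next
  assume d: "\<forall>i. d i \<ge> 0"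
  then have "x \<bullet> (spectral_mat P d *v x) \<ge> 0" for x
    by (simp add: quadratic_form_spectral sum_nonneg)
  then show "spectral_mat P d \<in> psd_cone"
    by (simp add: psd_cone_def spectral_mat_sym)
qed

text \<open>A preimage of a positive definite matrix keeps its eigenvectors and takes the logarithms
  of its eigenvalues.\<close>

lemma mat_exp_image_sym_mats: "mat_exp ` sym_mats = (pd_cone :: (real^'n^'n) set)"
proof safe
  fix A :: "real^'n^'n" assume "A \<in> sym_mats"
  then obtain P d where P: "orthogonal_matrix P" "A = spectral_mat P d"
    by (rule spectral_decomposition)
  then show "mat_exp A \<in> pd_cone"
    by (simp add: mat_exp_spectral spectral_mat_pd_iff)
next
  fix A :: "real^'n^'n" assume A: "A \<in> pd_cone"
  then have "A \<in> sym_mats" by (simp add: pd_cone_def)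
  then obtain P d where P: "orthogonal_matrix P" "A = spectral_mat P d"
    by (rule spectral_decomposition)
  with A have "\<forall>i. d i > 0" by (simp add: spectral_mat_pd_iff)
  then have "A = mat_exp (spectral_mat P (\<lambda>i. ln (d i)))"
    using P by (simp add: mat_exp_spectral)
  then show "A \<in> mat_exp ` sym_mats"
    using spectral_mat_sym by blast
qed

section \<open>Kronecker products in spectral form\<close>

lemma kronecker_nth: "(Y \<otimes>\<^sub>K Z) $ r $ c = Y $ fst r $ fst c * Z $ snd r $ snd c"
  by (simp add: kronecker_def)

lemma kronecker_mult:
  "((A :: real^'m^'m) \<otimes>\<^sub>K B) ** (C \<otimes>\<^sub>K D) = (A ** C) \<otimes>\<^sub>K (B ** (D :: real^'n^'n))"
  by (simp add: vec_eq_iff kronecker_nth matrix_matrix_mult_def sum_UNIV_prod sum_product mult_ac)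

lemma kronecker_transpose: "transpose (A \<otimes>\<^sub>K B) = transpose A \<otimes>\<^sub>K transpose B"
  by (simp add: vec_eq_iff kronecker_nth transpose_def)

lemma kronecker_mat_1: "(mat 1 :: 'a::semiring_1^'m^'m) \<otimes>\<^sub>K (mat 1 :: 'a^'n^'n) = mat 1"
  by (auto simp: vec_eq_iff kronecker_nth mat_def)

lemma kronecker_orthogonal_matrix:
  "orthogonal_matrix P \<Longrightarrow> orthogonal_matrix Q \<Longrightarrow> orthogonal_matrix ((P::real^'m^'m) \<otimes>\<^sub>K (Q::real^'n^'n))"
  by (simp add: orthogonal_matrix kronecker_mult kronecker_transpose kronecker_mat_1)

lemma kronecker_spectral:
  "spectral_mat P d \<otimes>\<^sub>K spectral_mat Q e = spectral_mat (P \<otimes>\<^sub>K Q) (\<lambda>(i, j). d i * e j)"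
  by (simp add: vec_eq_iff kronecker_nth spectral_mat_nth sum_UNIV_prod sum_product mult_ac)

lemma mat_exp_kronecker_sum:
  fixes A :: "real^'m^'m" and B :: "real^'n^'n"
  assumes "A \<in> sym_mats" "B \<in> sym_mats"
  shows "mat_exp (A \<otimes>\<^sub>K mat 1 + mat 1 \<otimes>\<^sub>K B) = mat_exp A \<otimes>\<^sub>K mat_exp B"
proof -
  obtain P d where P: "orthogonal_matrix P" "A = spectral_mat P d"
    by (rule spectral_decomposition[OF assms(1)])
  obtain Q e where Q: "orthogonal_matrix Q" "B = spectral_mat Q e"
    by (rule spectral_decomposition[OF assms(2)])
  \<comment> \<open>The two identity matrices are written in the eigenbases \<open>P\<close> and
    \<open>Q\<close>, which makes both summands diagonal in
    \<open>P \<otimes>\<^sub>K Q\<close>.\<close>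
  have "A \<otimes>\<^sub>K mat 1 + mat 1 \<otimes>\<^sub>K B = spectral_mat (P \<otimes>\<^sub>K Q) (\<lambda>(i, j). d i + e j)"
    unfolding P Q spectral_mat_const[OF P(1), symmetric] spectral_mat_const[OF Q(1), symmetric]
    by (simp add: kronecker_spectral spectral_mat_add split_def)
  then show ?thesis
    using P Q by (simp add: mat_exp_spectral kronecker_orthogonal_matrix kronecker_spectral exp_add split_def)
qed

lemma gibbs_manifold_qot_space:
  "gibbs_manifold qot_space = {Y \<otimes>\<^sub>K Z | (Y :: real^'m^'m) (Z :: real^'n^'n). Y \<in> pd_cone \<and> Z \<in> pd_cone}"
proof -
  have "gibbs_manifold qot_space = {mat_exp A \<otimes>\<^sub>K mat_exp B | (A :: real^'m^'m) (B :: real^'n^'n).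
      A \<in> sym_mats \<and> B \<in> sym_mats}"
    unfolding gibbs_manifold_def qot_space_eq using mat_exp_kronecker_sum by (force simp: image_iff)
  then show ?thesis
    unfolding mat_exp_image_sym_mats[symmetric] by blast
qed

text \<open>The eigenvalues of a Kronecker product are the products of the eigenvalues of its
  factors.\<close>

lemma kronecker_psd:
  fixes Y :: "real^'m^'m" and Z :: "real^'n^'n"
  assumes "Y \<in> psd_cone" "Z \<in> psd_cone"
  shows "Y \<otimes>\<^sub>K Z \<in> psd_cone"
proof -
  obtain P d where P: "orthogonal_matrix P" "Y = spectral_mat P d"
    using assms(1) by (auto simp: psd_cone_def elim: spectral_decomposition)
  obtain Q e where Q: "orthogonal_matrix Q" "Z = spectral_mat Q e"
    using assms(2) by (auto simp: psd_cone_def elim: spectral_decomposition)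
  show ?thesis
    using assms unfolding P Q kronecker_spectral
    by (simp add: P Q spectral_mat_psd_iff kronecker_orthogonal_matrix split_def)
qed

lemma kronecker_pd:
  fixes Y :: "real^'m^'m" and Z :: "real^'n^'n"
  assumes "Y \<in> pd_cone" "Z \<in> pd_cone"
  shows "Y \<otimes>\<^sub>K Z \<in> pd_cone"
proof -
  obtain P d where P: "orthogonal_matrix P" "Y = spectral_mat P d"
    using assms(1) by (auto simp: pd_cone_def elim: spectral_decomposition)
  obtain Q e where Q: "orthogonal_matrix Q" "Z = spectral_mat Q e"
    using assms(2) by (auto simp: pd_cone_def elim: spectral_decomposition)
  show ?thesis
    using assms unfolding P Q kronecker_spectral
    by (simp add: P Q spectral_mat_pd_iff kronecker_orthogonal_matrix split_def)
qed

lemma pd_cone_subset_psd_cone: "(pd_cone :: (real^'n^'n) set) \<subseteq> psd_cone"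
proof
  fix A :: "real^'n^'n" assume "A \<in> pd_cone"
  then have "A \<in> sym_mats" "x \<noteq> 0 \<Longrightarrow> x \<bullet> (A *v x) > 0" for x
    by (auto simp: pd_cone_def)
  then show "A \<in> psd_cone"
    unfolding psd_cone_def by (auto, metis inner_zero_left less_eq_real_def)
qed

section \<open>Kronecker products of semidefinite matrices\<close>

lemma pd_cone_sym: "A \<in> pd_cone \<Longrightarrow> A \<in> sym_mats"
  and psd_cone_sym: "A \<in> psd_cone \<Longrightarrow> A \<in> sym_mats"
  by (auto simp: pd_cone_def psd_cone_def)

text \<open>The quadrics of the Segre variety: the \<open>2 \<times> 2\<close> minors of the matrix that has the entry
  \<open>X $ (i, j) $ (k, l)\<close> in row \<open>(i, k)\<close> and column \<open>(j, l)\<close>.\<close>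

definition kronecker_minors_vanish :: "'a::comm_ring_1^('m::finite \<times> 'n::finite)^('m \<times> 'n) \<Rightarrow> bool" where
  "kronecker_minors_vanish X \<longleftrightarrow> (\<forall>i j k l i' j' k' l'.
     X $ (i, j) $ (k, l) * X $ (i', j') $ (k', l') = X $ (i', j) $ (k', l) * X $ (i, j') $ (k, l'))"

lemma kronecker_minors_vanish_kronecker: "kronecker_minors_vanish (Y \<otimes>\<^sub>K Z)"
  by (simp add: kronecker_minors_vanish_def kronecker_nth mult_ac)

text \<open>The rearranged matrix has rank one, so it is recovered from the column and the row
  through a nonzero pivot \<open>c\<close>. The division by the pivot is put into the second
  factor.\<close>

lemma kronecker_minors_vanishD:
  fixes X :: "'a::field^('m::finite \<times> 'n::finite)^('m \<times> 'n)"
  assumes "kronecker_minors_vanish X" "X $ (i, j) $ (k, l) = c" "c \<noteq> 0"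
  shows "X = (\<chi> a b. X $ (a, j) $ (b, l)) \<otimes>\<^sub>K (\<chi> a b. inverse c * X $ (i, a) $ (k, b))"
proof -
  have "X $ (a, b) $ (a', b') * X $ (i, j) $ (k, l) = X $ (i, b) $ (k, b') * X $ (a, j) $ (a', l)" for a b a' b'
    using assms(1) unfolding kronecker_minors_vanish_def by blast
  then show ?thesis
    using assms(2,3) by (simp add: vec_eq_iff kronecker_nth field_simps)
qed

lemma quadratic_form_sum: "x \<bullet> (A *v x) = (\<Sum>i\<in>UNIV. \<Sum>j\<in>UNIV. x $ i * (A $ i $ j * x $ j))"
  by (simp add: inner_vec_def matrix_vector_mult_def sum_distrib_left)

lemma sum_extend_by_zero:
  fixes g :: "'m::finite \<Rightarrow> 'n::finite" and x :: "'m \<Rightarrow> real"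
  shows "(\<Sum>r\<in>UNIV. (\<Sum>i\<in>UNIV. if g i = r then x i else 0) * h r) = (\<Sum>i\<in>UNIV. x i * h (g i))"
proof -
  have "(\<Sum>r\<in>UNIV. (\<Sum>i\<in>UNIV. if g i = r then x i else 0) * h r)
      = (\<Sum>r\<in>UNIV. \<Sum>i\<in>UNIV. if g i = r then x i * h (g i) else 0)"
    by (auto simp: sum_distrib_right intro!: sum.cong)
  also have "\<dots> = (\<Sum>i\<in>UNIV. \<Sum>r\<in>UNIV. if g i = r then x i * h (g i) else 0)"
    by (rule sum.swap)
  finally show ?thesis by simp
qed

text \<open>The vector \<open>y\<close> is the push-forward of \<open>x\<close> along
  \<open>g\<close>, so a submatrix inherits its definiteness from \<open>X\<close>. The factor
  \<open>c\<close> accommodates the division by the pivot.\<close>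

lemma quadratic_form_submatrix:
  fixes X :: "real^'n^'n" and g :: "'m::finite \<Rightarrow> 'n" and x :: "real^'m"
  defines "y \<equiv> (\<chi> r. \<Sum>i\<in>UNIV. if g i = r then x $ i else 0)"
  shows "x \<bullet> ((\<chi> i k. c * X $ g i $ g k) *v x) = c * (y \<bullet> (X *v y))"
proof -
  have ext: "(\<Sum>r\<in>UNIV. y $ r * h r) = (\<Sum>i\<in>UNIV. x $ i * h (g i))" for h
    by (simp add: y_def sum_extend_by_zero)
  have "y \<bullet> (X *v y) = (\<Sum>r\<in>UNIV. y $ r * (\<Sum>s\<in>UNIV. y $ s * X $ r $ s))"
    by (simp add: inner_vec_def matrix_vector_mult_def mult.commute)
  also have "\<dots> = (\<Sum>i\<in>UNIV. \<Sum>k\<in>UNIV. x $ i * (X $ g i $ g k * x $ k))"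
    unfolding ext by (simp add: sum_distrib_left mult_ac)
  finally have "y \<bullet> (X *v y) = (\<Sum>i\<in>UNIV. \<Sum>k\<in>UNIV. x $ i * (X $ g i $ g k * x $ k))" .
  then show ?thesis
    by (simp add: quadratic_form_sum sum_distrib_left mult_ac)
qed

lemma psd_submatrix:
  fixes X :: "real^'n^'n" and g :: "'m::finite \<Rightarrow> 'n"
  assumes "X \<in> psd_cone" "c \<ge> 0"
  shows "(\<chi> i k. c * X $ g i $ g k) \<in> psd_cone"
  using assms sym_matsD[of X]
  by (auto simp: psd_cone_def quadratic_form_submatrix intro!: sym_matsI)

lemma pd_submatrix:
  fixes X :: "real^'n^'n" and g :: "'m::finite \<Rightarrow> 'n"
  assumes "X \<in> pd_cone" "c > 0" "inj g"
  shows "(\<chi> i k. c * X $ g i $ g k) \<in> pd_cone"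
proof -
  \<comment> \<open>Injectivity of \<open>g\<close> leaves a single summand at \<open>g k\<close>,
    namely \<open>x $ k\<close>, so the push-forward stays nonzero.\<close>
  have "(\<chi> r. \<Sum>i\<in>UNIV. if g i = r then x $ i else 0) \<noteq> 0" if x: "x \<noteq> 0" for x :: "real^'m"
  proof -
    obtain k where "x $ k \<noteq> 0" using x by (auto simp: vec_eq_iff)
    then have "(\<chi> r. \<Sum>i\<in>UNIV. if g i = r then x $ i else 0) $ g k \<noteq> 0"
      using assms(3) by (simp add: inj_eq)
    then show ?thesis by (metis zero_index)
  qed
  then show ?thesis
    using assms(1,2) sym_matsD[OF pd_cone_sym[OF assms(1)]]
    by (auto simp: pd_cone_def quadratic_form_submatrix intro!: sym_matsI)
qed

lemma quadratic_form_axis: "axis i 1 \<bullet> (A *v axis i 1) = (A :: real^'n^'n) $ i $ i"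
  by (simp add: matrix_vector_mult_basis inner_axis' column_def)

text \<open>A diagonal entry is a sum of nonnegative terms, eigenvalue times squared entry of
  \<open>P\<close>. If all of them vanish, each term has a zero factor, which also kills the
  off-diagonal entries.\<close>

lemma psd_diagonal_zero:
  assumes "X \<in> psd_cone" "\<And>i. X $ i $ i = 0"
  shows "X = 0"
proof -
  obtain P d where P: "orthogonal_matrix P" "X = spectral_mat P d"
    using spectral_decomposition[OF psd_cone_sym[OF assms(1)]] by blast
  have d: "d l \<ge> 0" for l using assms(1) P spectral_mat_psd_iff by blast
  have "P $ i $ l * d l * P $ i $ l \<ge> 0" for i l
    using d[of l] by (simp add: mult.commute mult.left_commute)
  then have "P $ i $ l * d l * P $ i $ l = 0" for i l
    using assms(2)[of i] sum_nonneg_eq_0_iff[of UNIV "\<lambda>l. P $ i $ l * d l * P $ i $ l"]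
    by (simp add: P spectral_mat_nth)
  then have "P $ i $ l * d l * P $ j $ l = 0" for i j l by (metis mult_eq_0_iff)
  then have "X $ i $ j = 0" for i j
    unfolding P spectral_mat_nth by (intro sum.neutral) blast
  then show ?thesis by (simp add: vec_eq_iff)
qed

text \<open>With a diagonal pivot both factors are nonnegative multiples of principal submatrices of
  \<open>X\<close>, hence semidefinite. If every diagonal entry is zero, then so is
  \<open>X\<close>.\<close>

lemma psd_kronecker_iff:
  fixes X :: "real^('m::finite \<times> 'n::finite)^('m \<times> 'n)"
  shows "(\<exists>Y Z. X = Y \<otimes>\<^sub>K Z \<and> Y \<in> psd_cone \<and> Z \<in> psd_cone) \<longleftrightarrow> X \<in> psd_cone \<and> kronecker_minors_vanish X"
    (is "?L \<longleftrightarrow> ?R")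
proof
  assume ?R
  then have psd: "X \<in> psd_cone" and mv: "kronecker_minors_vanish X" by auto
  show ?L
  proof (cases "\<forall>i. X $ i $ i = 0")
    case True
    then have "X = 0" using psd psd_diagonal_zero by blast
    then have "X = (0 :: real^'m^'m) \<otimes>\<^sub>K (0 :: real^'n^'n)" by (simp add: vec_eq_iff kronecker_nth)
    moreover have "0 \<in> (psd_cone :: (real^'m^'m) set)" "0 \<in> (psd_cone :: (real^'n^'n) set)"
      by (auto simp: psd_cone_def sym_mats_def transpose_def vec_eq_iff)
    ultimately show ?thesis by blast
  next
    case False
    then obtain i j where ij: "X $ (i, j) $ (i, j) \<noteq> 0" by auto
    let ?c = "X $ (i, j) $ (i, j)"
    have "?c \<ge> 0" using psd quadratic_form_axis[of "(i, j)" X] unfolding psd_cone_def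
      by (metis (no_types, lifting) mem_Collect_eq)
    then have "X = (\<chi> a b. 1 * X $ (a, j) $ (b, j)) \<otimes>\<^sub>K (\<chi> a b. inverse ?c * X $ (i, a) $ (i, b))"
      "(\<chi> a b. 1 * X $ (a, j) $ (b, j)) \<in> psd_cone" "(\<chi> a b. inverse ?c * X $ (i, a) $ (i, b)) \<in> psd_cone"
      using kronecker_minors_vanishD[OF mv refl ij] psd_submatrix[OF psd, of 1 "\<lambda>a. (a, j)"]
        psd_submatrix[OF psd, of "inverse ?c" "\<lambda>a. (i, a)"] by simp_all
    then show ?thesis by blast
  qed
qed (auto simp: kronecker_psd kronecker_minors_vanish_kronecker)

lemma pd_kronecker_iff:
  fixes X :: "real^('m::finite \<times> 'n::finite)^('m \<times> 'n)"
  shows "(\<exists>Y Z. X = Y \<otimes>\<^sub>K Z \<and> Y \<in> pd_cone \<and> Z \<in> pd_cone) \<longleftrightarrow> X \<in> pd_cone \<and> kronecker_minors_vanish X"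
    (is "?L \<longleftrightarrow> ?R")
proof
  assume ?R
  then have pd: "X \<in> pd_cone" and mv: "kronecker_minors_vanish X" by auto
  \<comment> \<open>Any diagonal position serves as pivot here, since a positive definite matrix has
    a positive diagonal.\<close>
  fix i :: 'm and j :: 'n
  let ?c = "X $ (i, j) $ (i, j)"
  have "(axis (i, j) 1 :: real^('m \<times> 'n)) \<noteq> 0" by simp
  then have "axis (i, j) 1 \<bullet> (X *v axis (i, j) 1) > 0"
    using pd unfolding pd_cone_def by blast
  then have c: "?c > 0" by (simp add: quadratic_form_axis)
  then have "X = (\<chi> a b. 1 * X $ (a, j) $ (b, j)) \<otimes>\<^sub>K (\<chi> a b. inverse ?c * X $ (i, a) $ (i, b))"
    "(\<chi> a b. 1 * X $ (a, j) $ (b, j)) \<in> pd_cone" "(\<chi> a b. inverse ?c * X $ (i, a) $ (i, b)) \<in> pd_cone"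
    using kronecker_minors_vanishD[OF mv refl, of i j i j] pd_submatrix[OF pd, of 1 "\<lambda>a. (a, j)"]
      pd_submatrix[OF pd, of "inverse ?c" "\<lambda>a. (i, a)"] by (simp_all add: inj_def)
  then show ?L by blast
qed (auto simp: kronecker_pd kronecker_minors_vanish_kronecker)

section \<open>Closure of the positive definite Kronecker products\<close>

lemma closed_psd_cone: "closed (psd_cone :: (real^'n^'n) set)"
proof -
  have "psd_cone = {A :: real^'n^'n. \<forall>i j. A $ i $ j = A $ j $ i} \<inter>
      {A. \<forall>x. 0 \<le> (\<Sum>i\<in>UNIV. \<Sum>j\<in>UNIV. x $ i * (A $ i $ j * x $ j))}"
    by (auto simp: psd_cone_def quadratic_form_sum sym_matsD intro!: sym_matsI)
  also have "closed \<dots>"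
    by (intro closed_Int closed_Collect_all closed_Collect_eq closed_Collect_le continuous_intros)
  finally show ?thesis .
qed

lemma closed_kronecker_minors_vanish:
  "closed {X :: real^('m::finite \<times> 'n::finite)^('m \<times> 'n). kronecker_minors_vanish X}"
  unfolding kronecker_minors_vanish_def
  by (intro closed_Collect_all closed_Collect_eq continuous_intros)

lemma psd_add_mat_pd:
  fixes A :: "real^'n^'n"
  assumes "A \<in> psd_cone" "e > 0"
  shows "A + mat e \<in> pd_cone"
proof -
  have "(mat e :: real^'n^'n) *v x = e *\<^sub>R x" for x :: "real^'n"
    by (simp add: vec_eq_iff matrix_vector_mult_def mat_def if_distrib if_distribR cong: if_cong)
  then have "x \<bullet> ((A + mat e) *v x) = x \<bullet> (A *v x) + e * (x \<bullet> x)" for x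
    by (simp add: matrix_vector_mult_add_rdistrib inner_add_right)
  moreover have "A + mat e \<in> sym_mats"
    using sym_matsD[OF psd_cone_sym[OF assms(1)]] by (auto intro!: sym_matsI simp: mat_def)
  ultimately show ?thesis
    using assms by (auto simp: psd_cone_def pd_cone_def intro!: add_nonneg_pos)
qed

text \<open>The right-hand side is closed, being cut out by semidefiniteness and the minors. Its
  singular members are limits of products whose factors are shifted by small multiples of the
  identity.\<close>

lemma closure_pd_kronecker:
  "closure {Y \<otimes>\<^sub>K Z | (Y :: real^'m^'m) (Z :: real^'n^'n). Y \<in> pd_cone \<and> Z \<in> pd_cone}
    = {Y \<otimes>\<^sub>K Z | (Y :: real^'m^'m) (Z :: real^'n^'n). Y \<in> psd_cone \<and> Z \<in> psd_cone}"
  (is "closure ?G = ?T")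
proof
  have "?T = psd_cone \<inter> {X. kronecker_minors_vanish X}"
    using psd_kronecker_iff by blast
  then have "closed ?T"
    by (simp only:) (intro closed_Int closed_psd_cone closed_kronecker_minors_vanish)
  moreover have "?G \<subseteq> ?T" 
    using pd_cone_subset_psd_cone[where 'n = 'm] pd_cone_subset_psd_cone[where 'n = 'n] by blast
  ultimately show "closure ?G \<subseteq> ?T" by (rule closure_minimal[rotated])
  show "?T \<subseteq> closure ?G"
  proof clarify
    fix Y :: "real^'m^'m" and Z :: "real^'n^'n"
    assume YZ: "Y \<in> psd_cone" "Z \<in> psd_cone"
    let ?e = "\<lambda>n. inverse (real (Suc n))"
    have "(\<lambda>n. (Y + mat (?e n)) \<otimes>\<^sub>K (Z + mat (?e n))) \<longlonglongrightarrow> Y \<otimes>\<^sub>K Z"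
    proof (intro vec_tendstoI)
      fix r c
      have *: "(\<lambda>n. W $ a $ b + (if a = b then ?e n else 0)) \<longlonglongrightarrow> W $ a $ b" for W :: "real^'k^'k" and a b
        using LIMSEQ_inverse_real_of_nat_add[of "W $ a $ b"] by (cases "a = b") simp_all
      show "(\<lambda>n. ((Y + mat (?e n)) \<otimes>\<^sub>K (Z + mat (?e n))) $ r $ c) \<longlonglongrightarrow> (Y \<otimes>\<^sub>K Z) $ r $ c"
        using tendsto_mult[OF *[of Y] *[of Z]] by (simp add: kronecker_nth mat_def del: of_nat_Suc)
    qed
    moreover have "(Y + mat (?e n)) \<otimes>\<^sub>K (Z + mat (?e n)) \<in> ?G" for n
      using YZ psd_add_mat_pd by (metis (mono_tags, lifting) mem_Collect_eq positive_imp_inverse_positive of_nat_0_less_iff zero_less_Suc)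
    ultimately show "Y \<otimes>\<^sub>K Z \<in> closure ?G"
      by (metis (no_types, lifting) closure_sequential)
  qed
qed

section \<open>Semialgebraicity\<close>

text \<open>The characteristic polynomial with the variable negated, up to sign. In this form its
  coefficients are the elementary symmetric functions of the eigenvalues, without alternating
  signs.\<close>

definition shifted_det :: "'a::comm_ring_1^'n^'n \<Rightarrow> 'a poly" where
  "shifted_det A = det (\<chi> i j. [:A $ i $ j, if i = j then 1 else 0:])"

lemma poly_shifted_det: "poly (shifted_det A) t = det (A + mat t)"
proof -
  have "poly [:A $ i $ j, if i = j then 1 else 0:] t = (A + mat t) $ i $ j" for i j
    by (simp add: mat_def)
  then show ?thesis
    unfolding shifted_det_def det_def by (simp add: poly_sum poly_prod del: poly_pCons)
qed

lemma shifted_det_spectral: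
  assumes "orthogonal_matrix P"
  shows "shifted_det (spectral_mat P d) = (\<Prod>i\<in>UNIV. [:d i, 1:])"
proof -
  have "poly (shifted_det (spectral_mat P d)) t = poly (\<Prod>i\<in>UNIV. [:d i, 1:]) t" for t
  proof -
    have "det P * det (transpose P) = 1"
      using assms by (metis det_I det_mul orthogonal_matrix_def)
    moreover have "spectral_mat P d + mat t = spectral_mat P (\<lambda>i. d i + t)"
      using spectral_mat_add[of P d "\<lambda>_. t"] spectral_mat_const[OF assms] by simp
    moreover have "det (diag_mat (\<lambda>i. d i + t)) = (\<Prod>i\<in>UNIV. d i + t)"
      by (subst det_diagonal) (auto simp: diag_mat_def)
    ultimately show ?thesis
      by (simp add: poly_shifted_det poly_prod spectral_mat_def det_mul)
  qed
  then show ?thesis by (simp add: poly_eq_poly_eq_iff[symmetric] fun_eq_iff)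
qed

text \<open>Nonnegativity is carried through the induction because at the top index
  \<open>d x * coeff ?q k\<close> contributes nothing positive, and positivity comes from the
  shifted coefficient.\<close>

lemma coeff_prod_linear:
  fixes d :: "'b \<Rightarrow> 'a::linordered_field"
  assumes "finite S" "\<And>i. i \<in> S \<Longrightarrow> d i > 0"
  shows "(k \<le> card S \<longrightarrow> coeff (\<Prod>i\<in>S. [:d i, 1:]) k > 0) \<and> coeff (\<Prod>i\<in>S. [:d i, 1:]) k \<ge> 0"
  using assms
proof (induction S arbitrary: k rule: finite_induct)
  case (insert x F)
  let ?q = "\<Prod>i\<in>F. [:d i, 1:]"
  have IH: "k \<le> card F \<Longrightarrow> coeff ?q k > 0" "coeff ?q k \<ge> 0" for k
    using insert.IH[of k] insert.prems by auto
  have dx: "d x > 0" using insert.prems by simp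
  have "coeff (\<Prod>i\<in>insert x F. [:d i, 1:]) k = d x * coeff ?q k + (case k of 0 \<Rightarrow> 0 | Suc m \<Rightarrow> coeff ?q m)"
    using insert.hyps by (simp add: coeff_pCons split: nat.split)
  then show ?case
    using insert.hyps IH[of k] IH[of "k - 1"] dx
    by (auto split: nat.split intro!: add_nonneg_pos add_nonneg_nonneg mult_nonneg_nonneg)
qed (simp add: coeff_1)

lemma pd_cone_iff_shifted_det:
  fixes A :: "real^'n^'n"
  assumes "A \<in> sym_mats"
  shows "A \<in> pd_cone \<longleftrightarrow> (\<forall>k\<le>CARD('n). coeff (shifted_det A) k > 0)"
proof -
  obtain P d where P: "orthogonal_matrix P" "A = spectral_mat P d"
    by (rule spectral_decomposition[OF assms])
  let ?q = "\<Prod>i\<in>UNIV. [:d i, 1:]"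
  have A: "shifted_det A = ?q" using P by (simp add: shifted_det_spectral)
  show ?thesis
  proof
    assume "A \<in> pd_cone"
    then have "d i > 0" for i using P spectral_mat_pd_iff by blast
    then show "\<forall>k\<le>CARD('n). coeff (shifted_det A) k > 0"
      using coeff_prod_linear[of UNIV d] by (simp add: A)
  next
    assume pos: "\<forall>k\<le>CARD('n). coeff (shifted_det A) k > 0"
    have "degree ?q \<le> CARD('n)"
      using degree_prod_sum_le[of UNIV "\<lambda>i. [:d i, 1:]"] by simp
    then have eq: "poly ?q t = (\<Sum>k\<le>CARD('n). coeff ?q k * t ^ k)" for t
      unfolding poly_altdef by (intro sum.mono_neutral_left) (auto simp: coeff_eq_0)
    have "d i > 0" for i
    proof (rule ccontr)
      assume "\<not> d i > 0"
      \<comment> \<open>Here \<open>- d i\<close> is nonnegative, so positive coefficients make the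
        polynomial positive there, the constant term alone ensuring strictness; yet
        \<open>- d i\<close> is a root.\<close>
      then have "(\<Sum>k\<le>CARD('n). coeff ?q k * (- d i) ^ k) > 0"
        using pos unfolding A by (intro sum_pos2[of _ 0]) (auto simp: less_imp_le)
      moreover have "poly ?q (- d i) = 0" by (auto simp: poly_prod)
      ultimately show False using eq by simp
    qed
    then show "A \<in> pd_cone" using P spectral_mat_pd_iff by blast
  qed
qed

lemma real_polynomial_function_entry: "real_polynomial_function (\<lambda>X :: real^'n^'m. X $ i $ j)"
  by (intro real_polynomial_function.intros(1) bounded_linear_compose[OF bounded_linear_vec_nth bounded_linear_vec_nth])

lemma real_polynomial_function_coeff_prod:
  assumes "finite S" "\<And>i k. i \<in> S \<Longrightarrow> real_polynomial_function (\<lambda>x. coeff (p i x) k)"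
  shows "real_polynomial_function (\<lambda>x. coeff (\<Prod>i\<in>S. p i x) k)"
  using assms
proof (induction S arbitrary: k rule: finite_induct)
  case (insert a S)
  then show ?case by (auto simp: coeff_mult intro!: real_polynomial_function_sum)
qed auto

lemma real_polynomial_function_coeff_shifted_det:
  "real_polynomial_function (\<lambda>A :: real^'n^'n. coeff (shifted_det A) k)"
proof -
  have "real_polynomial_function (\<lambda>A :: real^'n^'n. coeff [:A $ i $ j, c:] k)" for i j c k
  proof -
    have "coeff [:a, c:] k = (if k = 0 then a else if k = 1 then c else 0)" for a
      by (auto simp: coeff_pCons split: nat.split)
    then show ?thesis by (cases "k = 0") (auto simp: real_polynomial_function_entry)
  qed
  then have *: "real_polynomial_function (\<lambda>A :: real^'n^'n. coeff (\<Prod>i\<in>UNIV. [:A $ i $ p i, c i:]) k)" for p c k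
    by (intro real_polynomial_function_coeff_prod) auto
  \<comment> \<open>The signs of the permutations in the Leibniz formula are constant polynomials
    and pass through \<open>coeff\<close>.\<close>
  have "coeff (of_int z * q) k = of_int z * coeff q k" for z and q :: "real poly"
    by (simp add: of_int_poly)
  then show ?thesis
    unfolding shifted_det_def det_def coeff_sum vec_lambda_beta
    by (auto intro!: real_polynomial_function_sum real_polynomial_function.intros(4) * simp: finite_permutations)
qed

text \<open>One basic set is enough: the minors are the equations and the coefficients of
  \<open>shifted_det\<close> the strict inequalities.\<close>

lemma semialgebraic_pd_kronecker:
  "semialgebraic_in sym_mats
     {Y \<otimes>\<^sub>K Z | (Y :: real^'m^'m) (Z :: real^'n^'n). Y \<in> pd_cone \<and> Z \<in> pd_cone}"
proof -
  define p :: "'m \<times> 'n \<times> 'm \<times> 'n \<times> 'm \<times> 'n \<times> 'm \<times> 'n \<Rightarrow> real^('m \<times> 'n)^('m \<times> 'n) \<Rightarrow> real"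
    where "p = (\<lambda>(i, j, k, l, i', j', k', l') X.
      X $ (i, j) $ (k, l) * X $ (i', j') $ (k', l') - X $ (i', j) $ (k', l) * X $ (i, j') $ (k, l'))"
  define q where "q = (\<lambda>k (X :: real^('m \<times> 'n)^('m \<times> 'n)). coeff (shifted_det X) k)"
  let ?Q = "q ` {..CARD('m \<times> 'n)}"
  have p: "(\<forall>f\<in>range p. f X = 0) \<longleftrightarrow> kronecker_minors_vanish X" for X
    unfolding p_def kronecker_minors_vanish_def by auto
  have "{Y \<otimes>\<^sub>K Z | (Y :: real^'m^'m) (Z :: real^'n^'n). Y \<in> pd_cone \<and> Z \<in> pd_cone}
      = {X. X \<in> pd_cone \<and> kronecker_minors_vanish X}"
    using pd_kronecker_iff by blast
  also have "\<dots> = {X \<in> sym_mats. (\<forall>f\<in>range p. f X = 0) \<and> (\<forall>f\<in>?Q. f X > 0)}"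
  proof -
    have "X \<in> pd_cone \<longleftrightarrow> X \<in> sym_mats \<and> (\<forall>f\<in>?Q. f X > 0)" for X
      using pd_cone_iff_shifted_det[of X] pd_cone_sym[of X] by (auto simp: q_def simp del: card_prod)
    then show ?thesis unfolding p by blast
  qed
  finally have "{Y \<otimes>\<^sub>K Z | (Y :: real^'m^'m) (Z :: real^'n^'n). Y \<in> pd_cone \<and> Z \<in> pd_cone}
      = (\<Union>(P, Q)\<in>{(range p, ?Q)}. {X \<in> sym_mats. (\<forall>f\<in>P. f X = 0) \<and> (\<forall>f\<in>Q. f X > 0)})"
    by simp
  moreover have "\<forall>f\<in>range p \<union> ?Q. real_polynomial_function f"
    by (auto simp: p_def q_def intro!: real_polynomial_function_diff real_polynomial_function.intros(4)
      real_polynomial_function_coeff_shifted_det real_polynomial_function_entry)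
  ultimately show ?thesis
    unfolding semialgebraic_in_def by (intro exI[of _ "{(range p, ?Q)}"]) simp
qed

section \<open>The Zariski closure\<close>

lemma matrix_polynomial_function_diff:
  assumes "matrix_polynomial_function p" "matrix_polynomial_function q"
  shows "matrix_polynomial_function (\<lambda>X. p X - q X)"
  using matrix_polynomial_function.add[OF assms(1) matrix_polynomial_function.mult[OF
      matrix_polynomial_function.const[of "- 1"] assms(2)]] by simp

text \<open>Restriction to a polynomial curve reduces vanishing to one variable, where infinitely
  many zeros force the zero polynomial.\<close>

lemma matrix_polynomial_function_along_curve:
  fixes p :: "'a::idom^'n^'m \<Rightarrow> 'a"
  assumes "matrix_polynomial_function p" and M: "\<And>u i j. M u $ i $ j = poly (q i j) u"
  shows "\<exists>r. \<forall>u. p (M u) = poly r u"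
  using assms(1)
proof induction
  case (entry i j)
  show ?case by (rule exI[of _ "q i j"]) (simp add: M)
next
  case (const c)
  show ?case by (rule exI[of _ "[:c:]"]) simp
next
  case (add p q)
  then show ?case by (metis poly_add)
next
  case (mult p q)
  then show ?case by (metis poly_mult)
qed

section \<open>Curves of positive definite matrices\<close>

lemma quadratic_form_bound:
  fixes A :: "real^'n^'n"
  obtains K where "K > 0" "\<And>x. \<bar>x \<bullet> (A *v x)\<bar> \<le> K * (x \<bullet> x)"
proof -
  obtain K where K: "K > 0" "\<And>x. norm (A *v x) \<le> norm x * K"
    using bounded_linear.pos_bounded[OF matrix_vector_mul_bounded_linear[of A]] by blast
  have "\<bar>x \<bullet> (A *v x)\<bar> \<le> K * (x \<bullet> x)" for x
  proof -
    have "\<bar>x \<bullet> (A *v x)\<bar> \<le> norm x * norm (A *v x)" by (rule Cauchy_Schwarz_ineq2)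
    also have "\<dots> \<le> norm x * (norm x * K)" using K by (intro mult_left_mono) auto
    finally show ?thesis by (simp add: dot_square_norm power2_eq_square mult_ac)
  qed
  with K that show thesis by blast
qed

text \<open>The constant is the sum of bounds for the two quadratic forms:
  \<open>1 \<le> 1 + t\<^sup>2\<close> absorbs that of \<open>A\<close>, and
  \<open>\<bar>t\<bar> < 1 + t\<^sup>2\<close> strictly absorbs that of
  \<open>t *\<^sub>R B\<close>.\<close>

lemma pd_quadratic_curve:
  fixes A B :: "real^'n^'n"
  assumes "A \<in> sym_mats" "B \<in> sym_mats"
  obtains c where "\<And>t. mat (c * (1 + t\<^sup>2)) + A + t *\<^sub>R B \<in> pd_cone"
proof -
  obtain a where a: "a > 0" "\<And>x. \<bar>x \<bullet> (A *v x)\<bar> \<le> a * (x \<bullet> x)"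
    using quadratic_form_bound[of A] by blast
  obtain b where b: "b > 0" "\<And>x. \<bar>x \<bullet> (B *v x)\<bar> \<le> b * (x \<bullet> x)"
    using quadratic_form_bound[of B] by blast
  have "mat ((a + b) * (1 + t\<^sup>2)) + A + t *\<^sub>R B \<in> pd_cone" (is "?M \<in> _") for t
  proof -
    have "(mat e :: real^'n^'n) *v x = e *\<^sub>R x" for e and x :: "real^'n"
      by (simp add: vec_eq_iff matrix_vector_mult_def mat_def if_distrib if_distribR cong: if_cong)
    then have q: "x \<bullet> (?M *v x) = (a + b) * (1 + t\<^sup>2) * (x \<bullet> x) + x \<bullet> (A *v x) + t * (x \<bullet> (B *v x))" for x
      by (simp add: matrix_vector_mult_add_rdistrib inner_add_right scaleR_matrix_vector_assoc[symmetric])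
    have "x \<bullet> (?M *v x) > 0" if "x \<noteq> 0" for x
    proof -
      have x: "x \<bullet> x > 0" using that by simp
      have "\<bar>t\<bar> < 1 + t\<^sup>2"
      proof -
        have "0 \<le> (\<bar>t\<bar> - 1 / 2)\<^sup>2" by (rule zero_le_power2)
        also have "\<dots> = t\<^sup>2 - \<bar>t\<bar> + 1 / 4" by (simp add: power2_diff power_divide)
        finally show ?thesis by linarith
      qed
      then have "b * (x \<bullet> x) * \<bar>t\<bar> < b * (x \<bullet> x) * (1 + t\<^sup>2)"
        using b(1) x by simp
      moreover have "a * (x \<bullet> x) * 1 \<le> a * (x \<bullet> x) * (1 + t\<^sup>2)"
        using a(1) x by (intro mult_left_mono) auto
      moreover have "\<bar>t * (x \<bullet> (B *v x))\<bar> \<le> \<bar>t\<bar> * (b * (x \<bullet> x))"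
        unfolding abs_mult using b(2)[of x] by (intro mult_left_mono) auto
      moreover have "(a + b) * (1 + t\<^sup>2) * (x \<bullet> x) = a * (x \<bullet> x) * (1 + t\<^sup>2) + b * (x \<bullet> x) * (1 + t\<^sup>2)"
        by (simp add: algebra_simps)
      moreover have "\<bar>t\<bar> * (b * (x \<bullet> x)) = b * (x \<bullet> x) * \<bar>t\<bar>" by simp
      ultimately show ?thesis unfolding q using a(2)[of x] by linarith
    qed
    moreover have "?M \<in> sym_mats"
      using sym_matsD[OF assms(1)] sym_matsD[OF assms(2)] by (auto intro!: sym_matsI simp: mat_def)
    ultimately show ?thesis by (simp add: pd_cone_def)
  qed
  with that show thesis by blast
qed

text \<open>The multiple of the identity that makes the curve positive definite for real parameters
  has the factor \<open>1 + u\<^sup>2\<close>, which vanishes at \<open>u = \<i>\<close>.\<close>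

lemma complex_sym_mat_on_pd_curve:
  fixes Y :: "complex^'n^'n"
  assumes "Y \<in> sym_mats"
  obtains M q where "M \<i> = Y" "\<And>u i j. M u $ i $ j = poly (q i j) u"
    "\<And>t. \<exists>A\<in>pd_cone. M (complex_of_real t) = map_matrix complex_of_real A"
proof -
  have "map_matrix Re Y \<in> sym_mats" "map_matrix Im Y \<in> sym_mats"
    using sym_matsD[OF assms] by (auto intro!: sym_matsI simp: nth_map_matrix)
  then obtain c where c: "\<And>t. mat (c * (1 + t\<^sup>2)) + map_matrix Re Y + t *\<^sub>R map_matrix Im Y \<in> pd_cone"
    using pd_quadratic_curve by blast
  define q where "q = (\<lambda>i j. [:complex_of_real (Re (Y $ i $ j)), complex_of_real (Im (Y $ i $ j)):]
    + (if i = j then [:complex_of_real c, 0, complex_of_real c:] else 0))"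
  define M where "M = (\<lambda>u. \<chi> i j. poly (q i j) u)"
  have "M \<i> = Y"
    by (auto simp: M_def q_def vec_eq_iff complex_eq_iff)
  moreover have "M (complex_of_real t)
      = map_matrix complex_of_real (mat (c * (1 + t\<^sup>2)) + map_matrix Re Y + t *\<^sub>R map_matrix Im Y)" for t
    by (auto simp: M_def q_def vec_eq_iff nth_map_matrix mat_def power2_eq_square algebra_simps)
  ultimately show thesis
    using that[of M q] c by (auto simp: M_def)
qed

lemma zariski_closure_pd_kronecker:
  "zariski_closure_in sym_mats (map_matrix complex_of_real `
      {Y \<otimes>\<^sub>K Z | (Y :: real^'m^'m) (Z :: real^'n^'n). Y \<in> pd_cone \<and> Z \<in> pd_cone})
    = {Y \<otimes>\<^sub>K Z | (Y :: complex^'m^'m) (Z :: complex^'n^'n). Y \<in> sym_mats \<and> Z \<in> sym_mats}"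
  (is "zariski_closure_in sym_mats ?G = ?T")
proof
  have G: "map_matrix complex_of_real A \<otimes>\<^sub>K map_matrix complex_of_real B \<in> ?G"
    if "A \<in> pd_cone" "B \<in> pd_cone" for A :: "real^'m^'m" and B :: "real^'n^'n"
  proof -
    have "map_matrix complex_of_real A \<otimes>\<^sub>K map_matrix complex_of_real B = map_matrix complex_of_real (A \<otimes>\<^sub>K B)"
      by (intro vec_eq_iff[THEN iffD2] allI) (simp only: nth_map_matrix kronecker_nth of_real_mult)
    then show ?thesis
      using that by (intro image_eqI[where x = "A \<otimes>\<^sub>K B"]) auto
  qed
  show "?T \<subseteq> zariski_closure_in sym_mats ?G"
  proof clarify
    fix Y :: "complex^'m^'m" and Z :: "complex^'n^'n"
    assume Y: "Y \<in> sym_mats" and Z: "Z \<in> sym_mats"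
    obtain M q where M: "M \<i> = Y" "\<And>u i j. M u $ i $ j = poly (q i j) u"
      "\<And>t. \<exists>A\<in>pd_cone. M (complex_of_real t) = map_matrix complex_of_real A"
      using complex_sym_mat_on_pd_curve[OF Y] by metis
    obtain N r where N: "N \<i> = Z" "\<And>u i j. N u $ i $ j = poly (r i j) u"
      "\<And>t. \<exists>A\<in>pd_cone. N (complex_of_real t) = map_matrix complex_of_real A"
      using complex_sym_mat_on_pd_curve[OF Z] by metis
    have "p (Y \<otimes>\<^sub>K Z) = 0" if p: "matrix_polynomial_function p" "\<forall>X\<in>?G. p X = 0" for p
    proof -
      have "(M u \<otimes>\<^sub>K N u) $ i $ j = poly (q (fst i) (fst j) * r (snd i) (snd j)) u" for u i j
        by (simp add: kronecker_nth M N)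
      then obtain s where s: "\<And>u. p (M u \<otimes>\<^sub>K N u) = poly s u"
        using matrix_polynomial_function_along_curve[OF p(1), where M = "\<lambda>u. M u \<otimes>\<^sub>K N u"
            and q = "\<lambda>i j. q (fst i) (fst j) * r (snd i) (snd j)"] by blast
      have "poly s (complex_of_real t) = 0" for t
      proof -
        obtain A B where "A \<in> pd_cone" "M (complex_of_real t) = map_matrix complex_of_real A"
          "B \<in> pd_cone" "N (complex_of_real t) = map_matrix complex_of_real B"
          using M(3)[of t] N(3)[of t] by blast
        then have "M (complex_of_real t) \<otimes>\<^sub>K N (complex_of_real t) \<in> ?G"
          using G by (simp only:)
        then have "p (M (complex_of_real t) \<otimes>\<^sub>K N (complex_of_real t)) = 0"
          by (rule p(2)[rule_format])
        then show ?thesis by (simp only: s)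
      qed
      \<comment> \<open>Vanishing at all real parameters makes \<open>s\<close> zero, hence also its
        value at \<open>\<i>\<close>, where the curve passes through
        \<open>Y \<otimes>\<^sub>K Z\<close>.\<close>
      then have "range complex_of_real \<subseteq> {u. poly s u = 0}" by blast
      moreover have "infinite (range complex_of_real)"
        by (simp add: finite_image_iff inj_of_real infinite_UNIV_char_0)
      ultimately have "s = 0" using poly_roots_finite finite_subset by blast
      then show ?thesis using s[of \<i>] M(1) N(1) by simp
    qed
    moreover have "Y \<otimes>\<^sub>K Z \<in> sym_mats"
      using sym_matsD[OF Y] sym_matsD[OF Z] by (auto intro!: sym_matsI simp: kronecker_nth)
    ultimately show "Y \<otimes>\<^sub>K Z \<in> zariski_closure_in sym_mats ?G"
      unfolding zariski_closure_in_def by (intro CollectI conjI allI impI) auto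
  qed
  show "zariski_closure_in sym_mats ?G \<subseteq> ?T"
  proof
    fix X :: "complex^('m \<times> 'n)^('m \<times> 'n)"
    assume X: "X \<in> zariski_closure_in sym_mats ?G"
    \<comment> \<open>Polynomial identities of the real products persist at every point
      \<open>X\<close> of the closure.\<close>
    have vanish: "p X = 0" if p: "matrix_polynomial_function p"
      and vanish_on: "\<And>(A :: real^'m^'m) (B :: real^'n^'n). A \<in> sym_mats \<Longrightarrow> p (map_matrix complex_of_real (A \<otimes>\<^sub>K B)) = 0" for p
    proof -
      have "p W = 0" if "W \<in> ?G" for W
      proof -
        obtain A :: "real^'m^'m" and B :: "real^'n^'n"
          where W: "W = map_matrix complex_of_real (A \<otimes>\<^sub>K B)" and "A \<in> pd_cone"
          using \<open>W \<in> ?G\<close> by auto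
        then show ?thesis
          unfolding W using pd_cone_sym by (intro vanish_on) blast
      qed
      moreover have "\<forall>p. matrix_polynomial_function p \<and> (\<forall>Y\<in>?G. p Y = 0) \<longrightarrow> p X = 0"
        using X unfolding zariski_closure_in_def mem_Collect_eq by (rule conjunct2)
      ultimately show ?thesis using p(1) by simp
    qed
    have mv: "kronecker_minors_vanish X"
      unfolding kronecker_minors_vanish_def
    proof (intro allI)
      fix i j k l i' j' k' l'
      have "X $ (i, j) $ (k, l) * X $ (i', j') $ (k', l') - X $ (i', j) $ (k', l) * X $ (i, j') $ (k, l') = 0"
        by (rule vanish) (auto intro!: matrix_polynomial_function_diff matrix_polynomial_function.intros
          simp: nth_map_matrix kronecker_nth)
      then show "X $ (i, j) $ (k, l) * X $ (i', j') $ (k', l') = X $ (i', j) $ (k', l) * X $ (i, j') $ (k, l')"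
        by simp
    qed
    \<comment> \<open>Symmetry of \<open>X\<close> only exchanges both index pairs at once.
      Invariance under transposing the first factor alone is a linear equation on the real
      products.\<close>
    have sym1: "X $ (i, j) $ (k, l) = X $ (k, j) $ (i, l)" for i j k l
    proof -
      have "X $ (i, j) $ (k, l) - X $ (k, j) $ (i, l) = 0"
        by (rule vanish) (auto intro!: matrix_polynomial_function_diff matrix_polynomial_function.intros
          simp: nth_map_matrix kronecker_nth sym_matsD[of _ i k])
      then show ?thesis by simp
    qed
    have sym2: "X $ (i, j) $ (k, l) = X $ (i, l) $ (k, j)" for i j k l
    proof -
      have "X \<in> sym_mats" using X by (simp add: zariski_closure_in_def)
      then have "X $ (i, j) $ (k, l) = X $ (k, l) $ (i, j)" by (rule sym_matsD)
      then show ?thesis using sym1 by simp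
    qed
    show "X \<in> ?T"
    proof (cases "X = 0")
      case True
      then have "X = (0 :: complex^'m^'m) \<otimes>\<^sub>K (0 :: complex^'n^'n)" by (simp add: vec_eq_iff kronecker_nth)
      moreover have "(0 :: complex^'m^'m) \<in> sym_mats" "(0 :: complex^'n^'n) \<in> sym_mats"
        by (auto intro: sym_matsI)
      ultimately show ?thesis by blast
    next
      case False
      \<comment> \<open>The pivot may lie off the diagonal: a nonzero complex symmetric matrix can
        have a zero diagonal. Symmetry of the two factors comes from \<open>sym1\<close> and
        \<open>sym2\<close>.\<close>
      then obtain i j k l where "X $ (i, j) $ (k, l) \<noteq> 0" by (auto simp: vec_eq_iff)
      from kronecker_minors_vanishD[OF mv refl this]
      have "X = (\<chi> a b. X $ (a, j) $ (b, l)) \<otimes>\<^sub>K (\<chi> a b. inverse (X $ (i, j) $ (k, l)) * X $ (i, a) $ (k, b))" .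
      moreover have "(\<chi> a b. X $ (a, j) $ (b, l)) \<in> sym_mats"
        "(\<chi> a b. inverse (X $ (i, j) $ (k, l)) * X $ (i, a) $ (k, b)) \<in> sym_mats"
        using sym1 sym2 by (auto intro!: sym_matsI)
      ultimately show ?thesis by blast
    qed
  qed
qed

section \<open>The cone over the Segre variety\<close>

text \<open>The sets \<open>{i, k}\<close> are exactly those with one or two elements, and Pascal's
  rule adds up the two counts.\<close>

lemma card_unordered_pairs:
  "card (range (\<lambda>(i :: 'a::finite, k). {i, k})) = (CARD('a::finite) + 1) choose 2"
proof -
  have "range (\<lambda>(i :: 'a, k). {i, k}) = {S. S \<subseteq> UNIV \<and> card S = 1} \<union> {S. S \<subseteq> UNIV \<and> card S = 2}"
    by (auto simp: card_insert_if card_1_singleton_iff card_2_iff image_iff)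
  also have "card \<dots> = (CARD('a) choose 1) + (CARD('a) choose 2)"
    by (subst card_Un_disjoint) (use n_subsets[of "UNIV :: 'a set" 1] n_subsets[of "UNIV :: 'a set" 2] in auto)
  finally show ?thesis by (simp add: numeral_2_eq_2)
qed

text \<open>A numbering of the independent entries of a symmetric matrix, that is, of the
  homogeneous coordinates of one Segre factor.\<close>

definition unordered_pair_index :: "('a \<Rightarrow> 'a \<Rightarrow> 'n) \<Rightarrow> bool" where
  "unordered_pair_index a \<longleftrightarrow> (\<forall>r. \<exists>i k. a i k = r) \<and>
    (\<forall>i k i' k'. a i k = a i' k' \<longleftrightarrow> i = i' \<and> k = k' \<or> i = k' \<and> k = i')"

lemma unordered_pair_index_surj:
  assumes "unordered_pair_index a"
  obtains i k where "a i k = r"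
  using assms unfolding unordered_pair_index_def by meson

lemma ex_unordered_pair_index:
  assumes "CARD('n::finite) = (CARD('a::finite) + 1) choose 2"
  shows "\<exists>a :: 'a \<Rightarrow> 'a \<Rightarrow> 'n. unordered_pair_index a"
proof -
  obtain g where g: "bij_betw g (range (\<lambda>(i :: 'a, k). {i, k})) (UNIV :: 'n set)"
    using finite_same_card_bij[of "range (\<lambda>(i :: 'a, k). {i, k})" "UNIV :: 'n set"]
    by (auto simp: card_unordered_pairs assms)
  have "\<exists>i k. g {i, k} = r" for r
  proof -
    have "r \<in> g ` range (\<lambda>(i :: 'a, k). {i, k})"
      using g by (simp add: bij_betw_def)
    then show ?thesis by auto
  qed
  moreover have "g {i, k} = g {i', k'} \<longleftrightarrow> {i, k} = {i', k'}" for i k i' k'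
  proof (rule inj_on_eq_iff)
    show "inj_on g (range (\<lambda>(i :: 'a, k). {i, k}))"
      using g by (simp add: bij_betw_def)
  qed auto
  ultimately show ?thesis
    by (intro exI[of _ "\<lambda>i k. g {i, k}"]) (simp add: unordered_pair_index_def doubleton_eq_iff)
qed

text \<open>The scalar along a line is absorbed into the first factor, and the vertex is the tensor
  with zero factors.\<close>

lemma affine_cone_segre_variety:
  "affine_cone (segre_variety :: ('a::field^('n::finite \<times> 'm::finite)) set set) = {tensor_vec u v | u v. True}"
proof -
  have zero: "tensor_vec u v = 0" if "u = 0 \<or> v = 0" for u :: "'a^'n" and v :: "'a^'m"
    using that by (auto simp: vec_eq_iff tensor_vec_def)
  show ?thesis
  proof (intro equalityI subsetI)
    fix w :: "'a^('n \<times> 'm)" assume "w \<in> affine_cone segre_variety"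
    then consider "w = 0" | u v c where "w = c *s tensor_vec u v"
      unfolding affine_cone_def segre_variety_def proj_point_def by blast
    then show "w \<in> {tensor_vec u v | u v. True}"
    proof cases
      case 1
      then have "w = tensor_vec 0 0" by (simp add: zero)
      then show ?thesis by blast
    next
      case (2 u v c)
      then have "w = tensor_vec (c *s u) v" by (simp add: vec_eq_iff tensor_vec_def)
      then show ?thesis by blast
    qed
  next
    fix w :: "'a^('n \<times> 'm)" assume "w \<in> {tensor_vec u v | u v. True}"
    then obtain u v where w: "w = tensor_vec u v" by blast
    show "w \<in> affine_cone segre_variety"
    proof (cases "u = 0 \<or> v = 0")
      case True
      then show ?thesis by (simp add: w zero affine_cone_def)
    next
      case False
      then have "proj_point w \<in> segre_variety" unfolding segre_variety_def w by blast
      moreover have "w = 1 *s w" by simp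
      then have "w \<in> proj_point w" unfolding proj_point_def by blast
      ultimately show ?thesis unfolding affine_cone_def by blast
    qed
  qed
qed

lemma vector_space_map_matrix: "vector_space (\<lambda>c. map_matrix ((*) (c :: 'a::field)))"
  by unfold_locales (simp_all add: vec_eq_iff nth_map_matrix algebra_simps)

lemma sym_mats_eq_range:
  fixes x :: "'d::finite \<Rightarrow> 'd \<Rightarrow> 'k::finite"
  assumes "unordered_pair_index x"
  shows "(sym_mats :: ('a^'d^'d) set) = range (\<lambda>u. \<chi> i k. u $ x i k)"
proof safe
  fix Y :: "'a^'d^'d" assume Y: "Y \<in> sym_mats"
  \<comment> \<open>Each coordinate is read at a chosen pair with that number; the only alternative
    is the transposed pair, where \<open>Y\<close> has the same entry.\<close>
  define v where "v = (\<chi> r. let p = (SOME p. x (fst p) (snd p) = r) in Y $ fst p $ snd p)"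
  have "v $ x i k = Y $ i $ k" for i k
  proof -
    define p where "p = (SOME p. x (fst p) (snd p) = x i k)"
    have "x (fst p) (snd p) = x i k"
      unfolding p_def by (rule someI[of _ "(i, k)"]) simp
    then have "Y $ fst p $ snd p = Y $ i $ k"
      using assms sym_matsD[OF Y, of i k] by (auto simp: unordered_pair_index_def)
    then show ?thesis by (simp add: v_def p_def)
  qed
  then have "Y = (\<chi> i k. v $ x i k)" by (simp add: vec_eq_iff)
  then show "Y \<in> range (\<lambda>u. \<chi> i k. u $ x i k)" by blast
next
  fix u :: "'a^'k"
  have "x i k = x k i" for i k
    using assms by (simp add: unordered_pair_index_def)
  then show "(\<chi> i k. u $ x i k) \<in> sym_mats"
    by (intro sym_matsI) simp
qed

lemma linearly_isomorphic_segre_sym_kronecker: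
  assumes "CARD('n::finite) = (CARD('d1::finite) + 1) choose 2"
    and "CARD('m::finite) = (CARD('d2::finite) + 1) choose 2"
  shows "linearly_isomorphic (affine_cone (segre_variety :: ('a::field^('n \<times> 'm)) set set))
    {Y \<otimes>\<^sub>K Z | (Y :: 'a^'d1^'d1) (Z :: 'a^'d2^'d2). Y \<in> sym_mats \<and> Z \<in> sym_mats}"
proof -
  obtain a :: "'d1 \<Rightarrow> 'd1 \<Rightarrow> 'n" where a: "unordered_pair_index a"
    using ex_unordered_pair_index[OF assms(1)] by blast
  obtain b :: "'d2 \<Rightarrow> 'd2 \<Rightarrow> 'm" where b: "unordered_pair_index b"
    using ex_unordered_pair_index[OF assms(2)] by blast
  \<comment> \<open>This spreads a tensor over the matrix indices. It repeats coordinates but omits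
    none, since both numberings are surjective, so it is injective on the whole space.\<close>
  define f :: "'a^('n \<times> 'm) \<Rightarrow> 'a^('d1 \<times> 'd2)^('d1 \<times> 'd2)"
    where "f = (\<lambda>w. \<chi> r c. w $ (a (fst r) (fst c), b (snd r) (snd c)))"
  have lin: "Vector_Spaces.linear (*s) (\<lambda>c. map_matrix ((*) c)) f"
    unfolding Vector_Spaces.linear_iff
  proof (intro conjI allI)
    show "f (w + w') = f w + f w'" for w w'
      by (intro vec_eq_iff[THEN iffD2] allI) (simp only: f_def vec_lambda_beta vector_add_component)
    show "f (c *s w) = map_matrix ((*) c) (f w)" for c w
      by (intro vec_eq_iff[THEN iffD2] allI)
        (simp only: f_def vec_lambda_beta vector_smult_component nth_map_matrix)
  qed (rule vec.vector_space_axioms vector_space_map_matrix)+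
  have "inj f"
  proof (rule injI)
    fix w w' assume "f w = f w'"
    then have "f w $ (i, j) $ (k, l) = f w' $ (i, j) $ (k, l)" for i j k l
      by (simp only:)
    then have eq: "w $ (a i k, b j l) = w' $ (a i k, b j l)" for i j k l
      by (simp only: f_def vec_lambda_beta fst_conv snd_conv)
    show "w = w'"
      unfolding vec_eq_iff
    proof
      fix r :: "'n \<times> 'm"
      obtain i k where "a i k = fst r" by (rule unordered_pair_index_surj[OF a])
      moreover obtain j l where "b j l = snd r" by (rule unordered_pair_index_surj[OF b])
      ultimately have "r = (a i k, b j l)" by simp
      then show "w $ r = w' $ r" using eq by simp
    qed
  qed
  then have inj: "inj_on f (vec.span (affine_cone segre_variety))"
    by (rule inj_on_subset) (rule subset_UNIV)
  have ften: "f (tensor_vec u v) = (\<chi> i k. u $ a i k) \<otimes>\<^sub>K (\<chi> j l. v $ b j l)" for u v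
    by (simp add: f_def tensor_vec_def kronecker_def)
  have img: "f ` affine_cone segre_variety
      = {Y \<otimes>\<^sub>K Z | Y Z. Y \<in> sym_mats \<and> Z \<in> sym_mats}"
  proof (intro equalityI subsetI)
    fix X assume "X \<in> f ` affine_cone segre_variety"
    then obtain u v where "X = f (tensor_vec u v)"
      unfolding affine_cone_segre_variety by blast
    then have "X = (\<chi> i k. u $ a i k) \<otimes>\<^sub>K (\<chi> j l. v $ b j l)" by (simp only: ften)
    moreover have "(\<chi> i k. u $ a i k) \<in> sym_mats" "(\<chi> j l. v $ b j l) \<in> sym_mats"
      unfolding sym_mats_eq_range[OF a] sym_mats_eq_range[OF b] by (rule range_eqI, rule refl)+
    ultimately show "X \<in> {Y \<otimes>\<^sub>K Z | Y Z. Y \<in> sym_mats \<and> Z \<in> sym_mats}"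
      by (intro CollectI exI[of _ "\<chi> i k. u $ a i k"] exI[of _ "\<chi> j l. v $ b j l"] conjI)
  next
    fix X assume "X \<in> {(Y :: 'a^'d1^'d1) \<otimes>\<^sub>K (Z :: 'a^'d2^'d2) | Y Z. Y \<in> sym_mats \<and> Z \<in> sym_mats}"
    then obtain Y :: "'a^'d1^'d1" and Z :: "'a^'d2^'d2"
      where X: "X = Y \<otimes>\<^sub>K Z" and "Y \<in> sym_mats" "Z \<in> sym_mats" by blast
    then obtain u v where "Y = (\<chi> i k. u $ a i k)" "Z = (\<chi> j l. v $ b j l)"
      unfolding sym_mats_eq_range[OF a] sym_mats_eq_range[OF b] by blast
    then have "X = f (tensor_vec u v)" by (simp only: X ften)
    then show "X \<in> f ` affine_cone segre_variety"
      unfolding affine_cone_segre_variety by blast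
  qed
  show ?thesis
    unfolding linearly_isomorphic_def by (intro exI[of _ f] conjI lin inj img)
qed

text \<open>Exponentials are nonsingular, so the manifold itself has positive definite factors, and
  the semidefinite ones describe its closure. The types \<open>'n\<close> and \<open>'m\<close>
  index the homogeneous coordinates of the two projective spaces.\<close>

theorem theorem6p1:
  fixes L :: "(real^('d1::finite \<times> 'd2::finite)^('d1 \<times> 'd2)) set"
  assumes "L = qot_space"
    and "CARD('n::finite) = (CARD('d1) + 1) choose 2"
    and "CARD('m::finite) = (CARD('d2) + 1) choose 2"
  shows "gibbs_manifold L \<subseteq> psd_cone \<and>
    semialgebraic_in sym_mats (gibbs_manifold L) \<and>
    gibbs_manifold L = {Y \<otimes>\<^sub>K Z | (Y :: real^'d1^'d1) (Z :: real^'d2^'d2). Y \<in> pd_cone \<and> Z \<in> pd_cone} \<and>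
    closure (gibbs_manifold L) =
      {Y \<otimes>\<^sub>K Z | (Y :: real^'d1^'d1) (Z :: real^'d2^'d2). Y \<in> psd_cone \<and> Z \<in> psd_cone} \<and>
    linearly_isomorphic (affine_cone (segre_variety :: (complex^('n \<times> 'm)) set set)) (gibbs_variety L)"
proof -
  have G: "gibbs_manifold L = {Y \<otimes>\<^sub>K Z | (Y :: real^'d1^'d1) (Z :: real^'d2^'d2). Y \<in> pd_cone \<and> Z \<in> pd_cone}"
    unfolding assms(1) by (rule gibbs_manifold_qot_space)
  have "gibbs_manifold L \<subseteq> psd_cone"
    unfolding G using kronecker_pd pd_cone_subset_psd_cone by blast
  moreover have "linearly_isomorphic (affine_cone (segre_variety :: (complex^('n \<times> 'm)) set set)) (gibbs_variety L)"
    unfolding gibbs_variety_def G zariski_closure_pd_kronecker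
    by (rule linearly_isomorphic_segre_sym_kronecker[OF assms(2,3)])
  ultimately show ?thesis
    using semialgebraic_pd_kronecker closure_pd_kronecker by (simp add: G)
qed

end
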